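(* Let $w_0$ be the longest element of $W$. Each Schubert class $p_{[w]}$, $[w] \in W/W_J$, in $H^*(G/P)$ and in $H^*_T(G/P)$ can be obtained as $\delta_v\, p_{[w_0]}$ for some $v \in W$.
   Context: $G$ is a complex semisimple linear algebraic group, $T \subseteq B \subseteq P \subseteq G$ with $T$ a maximal torus, $B$ a Borel subgroup, $P$ a parabolic subgroup; $\mathfrak{t} = \mathrm{Lie}(T)$. $W=N(T)/T$ is the Weyl group, $\Delta^+$ the positive roots (those of $B$), $\alpha_1,\dots,\alpha_n$ the simple roots, $s_1,\dots,s_n$ the simple reflections, $s_\alpha$ the reflection in $\alpha$. $J \subseteq \{1,\dots,n\}$ is the subset corresponding to $P$ (so $i\in J$ iff $\mathfrak{g}_{-\alpha_i} \subseteq \mathrm{Lie}(P)$), $W_J = \langle s_i : i \in J\rangle$, $[w]=wW_J \in W/W_J$, and $\le_P$ is the Bruhat order on $W/W_J$, i.e. the Bruhat order of $W$ on unique minimal-length coset representatives. $S(\mathfrak{t}^* )$ is the symmetric algebra over $\mathbb{C}$, on which $W$ acts by algebra automorphisms extending its action on $\mathfrak{t}^*$. Cohomology has complex coefficients, and $H^*_T(G/P)$ is given in its GKM presentation: it is the ring (coordinatewise operations) of functions $p : W/W_J \to S(\mathfrak{t}^* )$ such that $p([s_\alpha w]) - p([w]) \in (\alpha)$ for all $w \in W$ and $\alpha\in\Delta^+$ with $[s_\alpha w] \neq [w]$. The group $W$ acts on $H^*_T(G/P)$ by $(w \cdot p)([v]) = w\big(p([w^{-1}v])\big)$. Moment graph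 of $G/P$: vertices $W/W_J$; for $\alpha \in \Delta^+$ there is an edge labeled $\alpha$ between $[w]$ and $[s_\alpha w]$ whenever $[s_\alpha w]\neq [w]$, directed $[w] \mapsto [s_\alpha w]$ if $w^{-1}(\alpha)<0$ and $[s_\alpha w]\mapsto [w]$ otherwise. The equivariant Schubert (flow-up) class $p_{[w]} \in H^*_T(G/P)$ is the homogeneous class supported exactly on the $[v]$ with $[v] \ge_P [w]$ and with $p_{[w]}([w])$ equal to the product of the labels of all edges directed out of $[w]$. These classes form an $S(\mathfrak{t}^* )$-module basis of $H^*_T(G/P)$. The divided difference operator $\delta_i$ on $H^*_T(G/P)$ is $\delta_i p = (p - s_i\cdot p)/\alpha_i$; for $v \in W$, $\delta_v = \delta_{i_1}\cdots\delta_{i_k}$ for any reduced factorization $v=s_{i_1}\cdots s_{i_k}$ (this is independent of the factorization, and $\delta_e$ is the identity). As a $\mathbb{C}$-module, $H^*(G/P)$ is viewed as the $\mathbb{C}$-span of the classes $p_{[w]}$ inside $H^*_T(G/P)$; the operators $\delta_i$ act on $H^*(G/P)$ through this identification. *)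

theory Defs
  imports "HOL-Analysis.Cartesian_Space" "HOL-Library.Poly_Mapping" "HOL-Library.FuncSet"
begin

text \<open>
  A complex semisimple group with a maximal torus and a Borel subgroup enters only through its
  root data.  The space \<open>\<tt>*\<close> is written in coordinates as \<^typ>\<open>complex^'n\<close>; the simple roots are
  indexed by the same type because they form a basis of it.  The coroot of \<open>\<beta>\<close> is the linear
  functional \<open>coroot R \<beta>\<close> on \<open>\<tt>*\<close>; its values at vectors \<open>\<beta>\<close> that are not roots are irrelevant.
\<close>

record ('n::finite) root_data =
  roots :: "(complex^'n) set"
  coroot :: "complex^'n \<Rightarrow> complex^'n \<Rightarrow> complex"
  simple :: "'n \<Rightarrow> complex^'n"

definition reflection :: "'n::finite root_data \<Rightarrow> complex^'n \<Rightarrow> complex^'n \<Rightarrow> complex^'n" where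
  "reflection R \<beta> x = x - coroot R \<beta> x *s \<beta>"

definition reduced_root_system :: "'n::finite root_data \<Rightarrow> bool" where
  "reduced_root_system R \<longleftrightarrow>
     finite (roots R) \<and> vec.span (roots R) = UNIV \<and> 0 \<notin> roots R \<and>
     (\<forall>\<beta>\<in>roots R.
        Vector_Spaces.linear (*s) (*) (coroot R \<beta>) \<and> coroot R \<beta> \<beta> = 2 \<and>
        (\<forall>\<gamma>\<in>roots R. coroot R \<beta> \<gamma> \<in> \<int> \<and> reflection R \<beta> \<gamma> \<in> roots R) \<and>
        (\<forall>c. c *s \<beta> \<in> roots R \<longrightarrow> c = 1 \<or> c = - 1))"

definition pos_roots :: "'n::finite root_data \<Rightarrow> (complex^'n) set" where
  "pos_roots R =
     {\<beta> \<in> roots R. \<exists>m :: 'n \<Rightarrow> nat. \<beta> = (\<Sum>i\<in>UNIV. of_nat (m i) *s simple R i)}"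

definition neg_roots :: "'n::finite root_data \<Rightarrow> (complex^'n) set" where
  "neg_roots R = uminus ` pos_roots R"

definition is_base :: "'n::finite root_data \<Rightarrow> bool" where
  "is_base R \<longleftrightarrow>
     range (simple R) \<subseteq> roots R \<and> inj (simple R) \<and> vec.independent (range (simple R)) \<and>
     roots R = pos_roots R \<union> neg_roots R"

definition semisimple_root_data :: "'n::finite root_data \<Rightarrow> bool" where
  "semisimple_root_data R \<longleftrightarrow> reduced_root_system R \<and> is_base R"


text \<open>The Weyl group is realised by its faithful action on \<open>\<tt>*\<close>.\<close>

text \<open>For a set \<open>S\<close> of involutions (such as reflections) this is the group generated by \<open>S\<close>.\<close>

inductive_set generated :: "('a \<Rightarrow> 'a) set \<Rightarrow> ('a \<Rightarrow> 'a) set" for S where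
  generated_id: "id \<in> generated S"
| generated_comp: "s \<in> S \<Longrightarrow> w \<in> generated S \<Longrightarrow> s \<circ> w \<in> generated S"

abbreviation simple_reflection :: "'n::finite root_data \<Rightarrow> 'n \<Rightarrow> complex^'n \<Rightarrow> complex^'n" where
  "simple_reflection R i \<equiv> reflection R (simple R i)"

definition weyl_group :: "'n::finite root_data \<Rightarrow> (complex^'n \<Rightarrow> complex^'n) set" where
  "weyl_group R = generated (reflection R ` roots R)"

definition parabolic_subgroup ::
  "'n::finite root_data \<Rightarrow> 'n set \<Rightarrow> (complex^'n \<Rightarrow> complex^'n) set" where
  "parabolic_subgroup R J = generated (simple_reflection R ` J)"

definition word_prod :: "'n::finite root_data \<Rightarrow> 'n list \<Rightarrow> complex^'n \<Rightarrow> complex^'n" where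
  "word_prod R is = foldr (\<lambda>i w. simple_reflection R i \<circ> w) is id"

definition weyl_length :: "'n::finite root_data \<Rightarrow> (complex^'n \<Rightarrow> complex^'n) \<Rightarrow> nat" where
  "weyl_length R w = (LEAST k. \<exists>is. length is = k \<and> word_prod R is = w)"

definition reduced_word ::
  "'n::finite root_data \<Rightarrow> (complex^'n \<Rightarrow> complex^'n) \<Rightarrow> 'n list \<Rightarrow> bool" where
  "reduced_word R w is \<longleftrightarrow> word_prod R is = w \<and> length is = weyl_length R w"

definition longest_element :: "'n::finite root_data \<Rightarrow> complex^'n \<Rightarrow> complex^'n" where
  "longest_element R =
     (THE w. w \<in> weyl_group R \<and> (\<forall>u\<in>weyl_group R. weyl_length R u \<le> weyl_length R w))"

definition bruhat_le ::
  "'n::finite root_data \<Rightarrow> (complex^'n \<Rightarrow> complex^'n) \<Rightarrow> (complex^'n \<Rightarrow> complex^'n) \<Rightarrow> bool" where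
  "bruhat_le R u w \<longleftrightarrow>
     (u, w) \<in> {(x, reflection R \<beta> \<circ> x) | x \<beta>. x \<in> weyl_group R \<and> \<beta> \<in> pos_roots R \<and>
                 weyl_length R x < weyl_length R (reflection R \<beta> \<circ> x)}\<^sup>*"


type_synonym 'n weyl_coset = "(complex^'n \<Rightarrow> complex^'n) set"

definition coset :: "'n::finite root_data \<Rightarrow> 'n set \<Rightarrow> (complex^'n \<Rightarrow> complex^'n) \<Rightarrow> 'n weyl_coset"
  where "coset R J w = (\<lambda>u. w \<circ> u) ` parabolic_subgroup R J"

definition cosets :: "'n::finite root_data \<Rightarrow> 'n set \<Rightarrow> 'n weyl_coset set" where
  "cosets R J = coset R J ` weyl_group R"

definition min_rep :: "'n::finite root_data \<Rightarrow> 'n weyl_coset \<Rightarrow> complex^'n \<Rightarrow> complex^'n" where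
  "min_rep R c = (THE w. w \<in> c \<and> (\<forall>u\<in>c. weyl_length R w \<le> weyl_length R u))"

definition bruhat_le_P :: "'n::finite root_data \<Rightarrow> 'n weyl_coset \<Rightarrow> 'n weyl_coset \<Rightarrow> bool" where
  "bruhat_le_P R c d \<longleftrightarrow> bruhat_le R (min_rep R c) (min_rep R d)"


text \<open>
  The symmetric algebra of \<open>\<tt>*\<close> is the polynomial ring over \<open>\<complex>\<close> in the coordinate basis of
  \<^typ>\<open>complex^'n\<close>: monomials are exponent vectors \<^typ>\<open>'n \<Rightarrow>\<^sub>0 nat\<close>.
\<close>

type_synonym 'n sym = "('n \<Rightarrow>\<^sub>0 nat) \<Rightarrow>\<^sub>0 complex"

definition sym_const :: "complex \<Rightarrow> 'n::finite sym" where
  "sym_const a = Poly_Mapping.single 0 a"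

definition sym_vec :: "complex^'n::finite \<Rightarrow> 'n sym" where
  "sym_vec x = (\<Sum>i\<in>UNIV. Poly_Mapping.single (Poly_Mapping.single i 1) (x $ i))"

text \<open>The algebra endomorphism extending a linear map \<open>w\<close> of \<open>\<tt>*\<close>: substitute \<open>w e\<^sub>i\<close> for \<open>e\<^sub>i\<close>.\<close>

definition sym_act :: "(complex^'n \<Rightarrow> complex^'n) \<Rightarrow> 'n::finite sym \<Rightarrow> 'n sym" where
  "sym_act w f =
     (\<Sum>m\<in>Poly_Mapping.keys f. sym_const (Poly_Mapping.lookup f m) *
        (\<Prod>i\<in>UNIV. sym_vec (w (axis i 1)) ^ Poly_Mapping.lookup m i))"

definition sym_homogeneous :: "nat \<Rightarrow> 'n::finite sym \<Rightarrow> bool" where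
  "sym_homogeneous d f \<longleftrightarrow>
     (\<forall>m\<in>Poly_Mapping.keys f. (\<Sum>i\<in>UNIV. Poly_Mapping.lookup m i) = d)"

definition exact_div :: "'a::comm_ring_1 \<Rightarrow> 'a \<Rightarrow> 'a" where
  "exact_div f g = (THE q. f = g * q)"


type_synonym 'n gkm_class = "'n weyl_coset \<Rightarrow> 'n sym"

definition equivariant_cohomology ::
  "'n::finite root_data \<Rightarrow> 'n set \<Rightarrow> 'n gkm_class set" where
  "equivariant_cohomology R J =
     {p \<in> cosets R J \<rightarrow>\<^sub>E UNIV.
        \<forall>w\<in>weyl_group R. \<forall>\<beta>\<in>pos_roots R.
          coset R J (reflection R \<beta> \<circ> w) \<noteq> coset R J w \<longrightarrow>
          sym_vec \<beta> dvd p (coset R J (reflection R \<beta> \<circ> w)) - p (coset R J w)}"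

definition class_act ::
  "'n::finite root_data \<Rightarrow> 'n set \<Rightarrow> (complex^'n \<Rightarrow> complex^'n) \<Rightarrow> 'n gkm_class \<Rightarrow> 'n gkm_class" where
  "class_act R J w p = (\<lambda>c\<in>cosets R J. sym_act w (p ((\<lambda>u. inv w \<circ> u) ` c)))"

text \<open>Edges are triples (source, label, target).\<close>

definition moment_graph ::
  "'n::finite root_data \<Rightarrow> 'n set \<Rightarrow> ('n weyl_coset \<times> (complex^'n) \<times> 'n weyl_coset) set" where
  "moment_graph R J =
     {if inv w \<beta> \<in> neg_roots R
        then (coset R J w, \<beta>, coset R J (reflection R \<beta> \<circ> w))
        else (coset R J (reflection R \<beta> \<circ> w), \<beta>, coset R J w)
      | w \<beta>. w \<in> weyl_group R \<and> \<beta> \<in> pos_roots R \<and>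
             coset R J (reflection R \<beta> \<circ> w) \<noteq> coset R J w}"

definition schubert :: "'n::finite root_data \<Rightarrow> 'n set \<Rightarrow> 'n weyl_coset \<Rightarrow> 'n gkm_class" where
  "schubert R J c =
     (THE p. p \<in> equivariant_cohomology R J \<and>
        (\<exists>k. \<forall>d\<in>cosets R J. sym_homogeneous k (p d)) \<and>
        {d \<in> cosets R J. p d \<noteq> 0} = {d \<in> cosets R J. bruhat_le_P R c d} \<and>
        p c = (\<Prod>(a, \<beta>, b) \<in> {e \<in> moment_graph R J. fst e = c}. sym_vec \<beta>))"


definition div_diff :: "'n::finite root_data \<Rightarrow> 'n set \<Rightarrow> 'n \<Rightarrow> 'n gkm_class \<Rightarrow> 'n gkm_class" where
  "div_diff R J i p =
     (\<lambda>c\<in>cosets R J.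
        exact_div (p c - class_act R J (simple_reflection R i) p c) (sym_vec (simple R i)))"

text \<open>
  Ordinary cohomology is the \<open>\<complex>\<close>-span of the Schubert classes, and the divided difference
  operators on it are the restrictions of those on equivariant cohomology (undefined elsewhere).
\<close>

definition ordinary_cohomology ::
  "'n::finite root_data \<Rightarrow> 'n set \<Rightarrow> 'n gkm_class set" where
  "ordinary_cohomology R J =
     {(\<lambda>c\<in>cosets R J. \<Sum>d\<in>cosets R J. sym_const (a d) * schubert R J d c) | a. True}"

definition div_diff_ord ::
  "'n::finite root_data \<Rightarrow> 'n set \<Rightarrow> 'n \<Rightarrow> 'n gkm_class \<Rightarrow> 'n gkm_class" where
  "div_diff_ord R J i = restrict (div_diff R J i) (ordinary_cohomology R J)"

text \<open>
  The composite \<open>D i\<^sub>1 \<circ> \<dots> \<circ> D i\<^sub>k\<close> along a reduced word of \<open>v\<close>.  For the divided difference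
  operators it does not depend on the word chosen.
\<close>

definition along_reduced_word ::
  "'n::finite root_data \<Rightarrow> ('n \<Rightarrow> 'b \<Rightarrow> 'b) \<Rightarrow> (complex^'n \<Rightarrow> complex^'n) \<Rightarrow> 'b \<Rightarrow> 'b" where
  "along_reduced_word R D v = foldr (\<lambda>i F. D i \<circ> F) (SOME is. reduced_word R v is) id"

end

theory Submission
  imports Defs
begin

text \<open>
  \<^bold>\<open>Why every Schubert class comes from the top one.\<close>
  Write \<open>[w]\<close> with \<open>w\<close> the minimal representative of its coset, and let \<open>u\<close> be the minimal
  representative of the coset of the longest element.  The heart of the matter is that, for
  \<open>s\<^sub>i w < w\<close>, the operator \<open>\<delta>\<^sub>i\<close> carries the Schubert class of \<open>w\<close> to that of \<open>s\<^sub>i w\<close>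
  (\<open>flow_up_down\<close>).  Every minimal representative \<open>w\<close> lies below \<open>u\<close> in the left weak order:
  \<open>w = v u\<close> with \<open>len v + len w = len u\<close> (\<open>reach_top_rep\<close>).  Lengths then force every letter of
  \<^emph>\<open>any\<close> reduced word of \<open>v\<close> to lower the length by exactly one, so \<open>\<delta>\<^sub>v\<close> takes the class of \<open>u\<close>
  down to the class of \<open>w\<close> through Schubert classes only (\<open>flow_up_along_word\<close>).  Each stage, being
  a Schubert class, lies in the ordinary cohomology, so the same \<open>v\<close> works there.

  \<^bold>\<open>Existence and uniqueness of Schubert classes.\<close>
  The Schubert class is a definite description, so the class with the defining properties has to be
  shown to exist and to be unique.  It is first described by a weaker condition, \<open>flow_up\<close>, in which
  the support is only \<^emph>\<open>contained\<close> in the Bruhat up-set.  Uniqueness follows from a degree count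
  (\<open>gkm_vanishing\<close>): at a minimal point \<open>[v]\<close> of its support, a GKM class is divisible by the labels of
  all \<open>len v\<close> edges leaving \<open>[v]\<close>, which are pairwise non-proportional linear forms, so its degree is
  at least \<open>len v\<close>.  The same count shows \<open>\<delta>\<^sub>i p = 0\<close> on the class \<open>p\<close> of \<open>w\<close> whenever \<open>s\<^sub>i w > w\<close>
  (\<open>flow_up_flat\<close>).  Existence starts at the top coset, where the class is concentrated in a
  single point, and descends by \<open>\<delta>\<^sub>i\<close>.

  That the support is the whole up-set is a positivity statement (\<open>flow_up_positive\<close>).  For
  \<open>s\<^sub>i y < y\<close> the definition of \<open>\<delta>\<^sub>i\<close> reads
  \<open>p([y]) = s\<^sub>i p([s\<^sub>i y]) + \<alpha>\<^sub>i (\<delta>\<^sub>i p)([y])\<close>, and \<open>\<delta>\<^sub>i p\<close> is either zero or again such a class and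
  invariant under \<open>s\<^sub>i\<close>.  Induction on \<open>len y\<close> shows that \<open>p([y])\<close> is a sum of products of
  inversions of \<open>y\<close>; hence it takes a positive value wherever all positive roots are positive, and
  does not vanish.

  \<^bold>\<open>The supporting theory.\<close>
  Simple reflections generate the Weyl group by an averaging argument over the finite group that they
  generate (\<open>pos_root_conjugate_simple\<close>), and a reflection is determined by its root because a
  nontrivial transvection cannot preserve a finite spanning set (\<open>reflection_image\<close>).  The Bruhat
  order interacts with simple reflections through one fact: passing from \<open>w\<close> to the shorter of \<open>w\<close>
  and \<open>s\<^sub>i w\<close> is monotone (\<open>shorter_mono\<close>).  It bounds the support of \<open>\<delta>\<^sub>i p\<close>, and it drives the
  induction in the positivity argument.
\<close>

section \<open>Substitution homomorphisms of the symmetric algebra\<close>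

text \<open>
  Substitution of ring elements for the coordinates, with the coefficients mapped by \<open>h\<close>.  Linear
  substitutions (\<open>sym_act\<close>) and evaluation at a point of \<open>\<tt>\<close> are both of this form.
\<close>
definition insertion :: "(complex \<Rightarrow> 'a::comm_ring_1) \<Rightarrow> ('n::finite \<Rightarrow> 'a) \<Rightarrow> 'n sym \<Rightarrow> 'a" where
  "insertion h \<phi> f =
     (\<Sum>m\<in>Poly_Mapping.keys f. h (Poly_Mapping.lookup f m) * (\<Prod>i\<in>UNIV. \<phi> i ^ Poly_Mapping.lookup m i))"

lemma sum_singles: "(\<Sum>m\<in>Poly_Mapping.keys f. Poly_Mapping.single m (Poly_Mapping.lookup f m)) = f"
proof (rule poly_mapping_eqI)
  fix k
  have "(\<Sum>m\<in>Poly_Mapping.keys f. Poly_Mapping.lookup f m when m = k) = Poly_Mapping.lookup f k"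
  proof (cases "k \<in> Poly_Mapping.keys f")
    case True
    then show ?thesis by (subst sum.remove[OF finite_keys True]) (auto intro!: sum.neutral simp: when_def)
  next
    case False
    then show ?thesis by (auto intro!: sum.neutral simp: when_def in_keys_iff)
  qed
  then show "Poly_Mapping.lookup (\<Sum>m\<in>Poly_Mapping.keys f. Poly_Mapping.single m (Poly_Mapping.lookup f m)) k
    = Poly_Mapping.lookup f k"
    by (simp add: lookup_sum lookup_single)
qed

locale coefficient_hom =
  fixes h :: "complex \<Rightarrow> 'a::comm_ring_1"
  assumes h_one: "h 1 = 1"
    and h_add: "h (a + b) = h a + h b"
    and h_mult: "h (a * b) = h a * h b"
begin

lemma h_zero: "h 0 = 0"
  using h_add[of 0 0] by simp

lemma insertion_superset:
  assumes "finite A" "Poly_Mapping.keys f \<subseteq> A"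
  shows "insertion h \<phi> f =
    (\<Sum>m\<in>A. h (Poly_Mapping.lookup f m) * (\<Prod>i\<in>UNIV. \<phi> i ^ Poly_Mapping.lookup m i))"
  unfolding insertion_def
  by (rule sum.mono_neutral_left) (use assms in \<open>auto simp: in_keys_iff h_zero\<close>)

lemma insertion_add: "insertion h \<phi> (f + g) = insertion h \<phi> f + insertion h \<phi> g"
proof -
  let ?A = "Poly_Mapping.keys f \<union> Poly_Mapping.keys g"
  have "Poly_Mapping.keys (f + g) \<subseteq> ?A" by (rule keys_add)
  then show ?thesis
    by (simp add: insertion_superset[where A = ?A] lookup_add h_add distrib_right sum.distrib)
qed

lemma insertion_zero [simp]: "insertion h \<phi> 0 = 0"
  by (simp add: insertion_def)

lemma insertion_sum: "insertion h \<phi> (sum F I) = (\<Sum>i\<in>I. insertion h \<phi> (F i))"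
  by (induction I rule: infinite_finite_induct) (auto simp: insertion_add)

lemma insertion_single:
  "insertion h \<phi> (Poly_Mapping.single m a) = h a * (\<Prod>i\<in>UNIV. \<phi> i ^ Poly_Mapping.lookup m i)"
  by (subst insertion_superset[where A = "{m}"]) auto

lemma insertion_mult: "insertion h \<phi> (f * g) = insertion h \<phi> f * insertion h \<phi> g"
proof -
  let ?l = Poly_Mapping.lookup and ?s = Poly_Mapping.single and ?K = Poly_Mapping.keys
  have "f * g = (\<Sum>m\<in>?K f. ?s m (?l f m)) * (\<Sum>m\<in>?K g. ?s m (?l g m))"
    by (simp add: sum_singles)
  also have "\<dots> = (\<Sum>m\<in>?K f. \<Sum>n\<in>?K g. ?s (m + n) (?l f m * ?l g n))"
    by (simp add: sum_product mult_single)
  finally have "insertion h \<phi> (f * g) = (\<Sum>m\<in>?K f. \<Sum>n\<in>?K g.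
      insertion h \<phi> (?s m (?l f m)) * insertion h \<phi> (?s n (?l g n)))"
    by (simp add: insertion_sum insertion_single h_mult lookup_add power_add prod.distrib
        algebra_simps)
  also have "\<dots> = insertion h \<phi> f * insertion h \<phi> g"
    unfolding sum_product[symmetric] insertion_sum[symmetric] sum_singles ..
  finally show ?thesis .
qed

lemma insertion_one [simp]: "insertion h \<phi> 1 = 1"
  using insertion_single[of \<phi> 0 1] by (simp add: h_one)

lemma insertion_uminus: "insertion h \<phi> (- f) = - insertion h \<phi> f"
  using insertion_add[of \<phi> "- f" f] by (simp add: eq_neg_iff_add_eq_0)

lemma insertion_diff: "insertion h \<phi> (f - g) = insertion h \<phi> f - insertion h \<phi> g"
  using insertion_add[of \<phi> f "- g"] by (simp add: insertion_uminus)

lemma insertion_power: "insertion h \<phi> (f ^ k) = insertion h \<phi> f ^ k"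
  by (induction k) (auto simp: insertion_mult)

lemma insertion_prod: "insertion h \<phi> (prod F I) = (\<Prod>i\<in>I. insertion h \<phi> (F i))"
  by (induction I rule: infinite_finite_induct) (auto simp: insertion_mult)

end

lemma sym_const_simps [simp]:
  "sym_const 0 = 0" "sym_const 1 = 1"
  by (simp_all add: sym_const_def)

lemma sym_const_add: "sym_const (a + b) = sym_const a + sym_const b"
  by (simp add: sym_const_def single_add)

lemma sym_const_mult: "sym_const (a * b) = sym_const a * sym_const b"
  by (simp add: sym_const_def mult_single)

interpretation coefficients: coefficient_hom sym_const
  by unfold_locales (auto simp: sym_const_add sym_const_mult)

interpretation evaluation: coefficient_hom "\<lambda>a. a"
  by unfold_locales auto

lemma sym_act_insertion: "sym_act w = insertion sym_const (\<lambda>i. sym_vec (w (axis i 1)))"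
  by (simp add: fun_eq_iff sym_act_def insertion_def)

lemma sym_act_simps [simp]: "sym_act w 0 = 0" "sym_act w 1 = 1"
  by (simp_all add: sym_act_insertion)

lemma
  shows sym_act_add: "sym_act w (f + g) = sym_act w f + sym_act w g"
    and sym_act_diff: "sym_act w (f - g) = sym_act w f - sym_act w g"
    and sym_act_mult: "sym_act w (f * g) = sym_act w f * sym_act w g"
    and sym_act_sum: "sym_act w (sum F I) = (\<Sum>i\<in>I. sym_act w (F i))"
    and sym_act_prod: "sym_act w (prod F I) = (\<Prod>i\<in>I. sym_act w (F i))"
    and sym_act_power: "sym_act w (f ^ k) = sym_act w f ^ k"
  by (simp_all add: sym_act_insertion coefficients.insertion_add coefficients.insertion_diff
      coefficients.insertion_mult coefficients.insertion_sum coefficients.insertion_prod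
      coefficients.insertion_power)

lemma (in coefficient_hom) insertion_const: "insertion h \<phi> (sym_const a) = h a"
  by (simp add: sym_const_def insertion_single)

lemma sym_act_const [simp]: "sym_act w (sym_const a) = sym_const a"
  by (simp add: sym_act_insertion coefficients.insertion_const)

lemma (in coefficient_hom) insertion_vec: "insertion h \<phi> (sym_vec x) = (\<Sum>i\<in>UNIV. h (x $ i) * \<phi> i)"
proof -
  have "(\<Prod>j\<in>UNIV. \<phi> j ^ Poly_Mapping.lookup (Poly_Mapping.single i 1) j) = \<phi> i" for i
    by (subst prod.remove[of _ i]) (auto intro!: prod.neutral simp: lookup_single when_def)
  then show ?thesis
    by (simp add: sym_vec_def insertion_sum insertion_single)
qed

lemma sym_vec_0 [simp]: "sym_vec 0 = 0"
  by (simp add: sym_vec_def)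

lemma sym_vec_add: "sym_vec (x + y) = sym_vec x + sym_vec y"
  by (simp add: sym_vec_def single_add sum.distrib)

lemma sym_vec_scale: "sym_vec (c *s x) = sym_const c * sym_vec x"
  by (simp add: sym_vec_def sym_const_def sum_distrib_left mult_single)

lemma sym_vec_uminus: "sym_vec (- x) = - sym_vec x"
  using sym_vec_add[of "- x" x] by (simp add: eq_neg_iff_add_eq_0)

lemma sym_vec_diff: "sym_vec (x - y) = sym_vec x - sym_vec y"
  using sym_vec_add[of x "- y"] by (simp add: sym_vec_uminus)

lemma sym_vec_sum: "sym_vec (sum F I) = (\<Sum>i\<in>I. sym_vec (F i))"
  by (induction I rule: infinite_finite_induct) (auto simp: sym_vec_add)

abbreviation linear_map :: "(complex^'n \<Rightarrow> complex^'n) \<Rightarrow> bool" where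
  "linear_map \<equiv> Vector_Spaces.linear (*s) (*s)"

lemma linear_mapI:
  assumes "\<And>x y. w (x + y) = w x + w y" "\<And>c x. w (c *s x) = c *s w x"
  shows "linear_map w"
  by unfold_locales (use assms in auto)

lemma sym_act_vec:
  assumes "linear_map w"
  shows "sym_act w (sym_vec x) = sym_vec (w x)"
proof -
  interpret w: Vector_Spaces.linear "(*s)" "(*s)" w by fact
  have "w x = w (\<Sum>i\<in>UNIV. x $ i *s axis i 1)" by (simp add: basis_expansion)
  then have "w x = (\<Sum>i\<in>UNIV. x $ i *s w (axis i 1))"
    by (simp add: w.sum w.scale)
  then show ?thesis
    by (simp add: sym_act_insertion coefficients.insertion_vec sym_vec_sum sym_vec_scale)
qed

lemma sym_act_comp:
  assumes "linear_map w"
  shows "sym_act w (sym_act u f) = sym_act (w \<circ> u) f"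
proof -
  have "sym_act w (sym_act u f) =
      sym_act w (\<Sum>m\<in>Poly_Mapping.keys f. sym_const (Poly_Mapping.lookup f m) *
        (\<Prod>i\<in>UNIV. sym_vec (u (axis i 1)) ^ Poly_Mapping.lookup m i))"
    by (simp add: sym_act_def[of u])
  also have "\<dots> = sym_act (w \<circ> u) f"
    by (simp add: sym_act_sum sym_act_mult sym_act_prod sym_act_power sym_act_vec[OF assms]
        sym_act_def[of "w \<circ> u"])
  finally show ?thesis .
qed

lemma prod_axes:
  fixes m :: "'n::finite \<Rightarrow>\<^sub>0 nat"
  shows "(\<Prod>i\<in>UNIV. sym_vec (axis i 1) ^ Poly_Mapping.lookup m i) = Poly_Mapping.single m 1"
proof -
  have vec: "sym_vec (axis i 1) = Poly_Mapping.single (Poly_Mapping.single i 1) 1" for i :: 'n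
    unfolding sym_vec_def
    by (subst sum.remove[of _ i]) (auto intro!: sum.neutral simp: axis_def)
  have pow: "sym_vec (axis i 1) ^ k = Poly_Mapping.single (Poly_Mapping.single i k) 1" for i :: 'n and k
    by (induction k) (auto simp: vec mult_single single_add[symmetric])
  have "(\<Prod>i\<in>I. sym_vec (axis i 1) ^ Poly_Mapping.lookup m i) =
      Poly_Mapping.single (\<Sum>i\<in>I. Poly_Mapping.single i (Poly_Mapping.lookup m i)) 1"
    if "finite I" for I
    using that by induction (auto simp: pow mult_single)
  moreover have "(\<Sum>i\<in>UNIV. Poly_Mapping.single i (Poly_Mapping.lookup m i)) = m"
  proof (rule poly_mapping_eqI)
    fix k
    show "Poly_Mapping.lookup (\<Sum>i\<in>UNIV. Poly_Mapping.single i (Poly_Mapping.lookup m i)) k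
      = Poly_Mapping.lookup m k"
      by (simp add: lookup_sum lookup_single when_def)
  qed
  ultimately show ?thesis by simp
qed

lemma sym_act_id [simp]: "sym_act id f = f"
  by (simp add: sym_act_def prod_axes sym_const_def mult_single sum_singles)

lemma dvd_power_diff:
  fixes a b d :: "'a::comm_ring_1"
  assumes "d dvd a - b"
  shows "d dvd a ^ k - b ^ k"
proof (induction k)
  case (Suc k)
  have "a ^ Suc k - b ^ Suc k = a * (a ^ k - b ^ k) + (a - b) * b ^ k"
    by (simp add: algebra_simps)
  then show ?case using Suc assms by (metis dvd_add dvd_mult dvd_mult2)
qed auto

lemma dvd_prod_diff:
  fixes d :: "'a::comm_ring_1"
  assumes "\<And>i. d dvd F i - G i"
  shows "d dvd prod F I - prod G I"
proof (induction I rule: infinite_finite_induct)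
  case (insert x I)
  have "prod F (insert x I) - prod G (insert x I) =
      F x * (prod F I - prod G I) + (F x - G x) * prod G I"
    using insert by (simp add: algebra_simps)
  then show ?case using insert assms by (metis dvd_add dvd_mult dvd_mult2)
qed auto

text \<open>
  Two substitutions that agree modulo \<open>d\<close> on the generators agree modulo \<open>d\<close> everywhere.  This gives
  both the integrality of divided differences and the divisibility criterion behind \<open>sym_vec_prime\<close>.
\<close>
lemma dvd_diff_sym_act:
  assumes "\<And>i. d dvd sym_vec (axis i 1) - sym_vec (w (axis i 1))"
  shows "d dvd f - sym_act w f"
proof -
  have "f - sym_act w f = sym_act id f - sym_act w f" by simp
  also have "\<dots> = (\<Sum>m\<in>Poly_Mapping.keys f. sym_const (Poly_Mapping.lookup f m) *
     ((\<Prod>i\<in>UNIV. sym_vec (axis i 1) ^ Poly_Mapping.lookup m i) -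
      (\<Prod>i\<in>UNIV. sym_vec (w (axis i 1)) ^ Poly_Mapping.lookup m i)))"
    by (simp add: sym_act_def algebra_simps sum_subtractf del: sym_act_id)
  also have "d dvd \<dots>"
    by (intro dvd_sum dvd_mult dvd_prod_diff dvd_power_diff assms)
  finally show ?thesis .
qed

section \<open>Linear forms are prime\<close>

text \<open>
  A linear form with nonzero \<open>i\<close>-th coordinate raises the top exponent of the \<open>i\<close>-th variable.
\<close>
lemma sym_vec_mult_eq_0:
  assumes "a \<noteq> 0" "sym_vec a * g = 0"
  shows "g = 0"
proof (rule ccontr)
  assume "g \<noteq> 0"
  let ?l = Poly_Mapping.lookup and ?s = Poly_Mapping.single and ?K = "Poly_Mapping.keys g"
  from \<open>a \<noteq> 0\<close> obtain i where i: "a $ i \<noteq> 0" by (auto simp: vec_eq_iff)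
  have "finite ?K" "?K \<noteq> {}" using \<open>g \<noteq> 0\<close> by auto
  (* Among the monomials of g choose m with the largest exponent at i: in the product, only
     m itself contributes to the monomial obtained by raising that exponent. *)
  then have "Max ((\<lambda>n. ?l n i) ` ?K) \<in> (\<lambda>n. ?l n i) ` ?K" by (intro Max_in) auto
  then obtain m where "m \<in> ?K" "?l m i = Max ((\<lambda>n. ?l n i) ` ?K)" by auto
  then have m: "m \<in> ?K" "\<And>n. n \<in> ?K \<Longrightarrow> ?l n i \<le> ?l m i"
    by (auto intro: Max_ge)
  have "sym_vec a * g = (\<Sum>j\<in>UNIV. ?s (?s j 1) (a $ j)) * (\<Sum>n\<in>?K. ?s n (?l g n))"
    by (simp add: sym_vec_def sum_singles)
  also have "\<dots> = (\<Sum>j\<in>UNIV. \<Sum>n\<in>?K. ?s (?s j 1 + n) (a $ j * ?l g n))"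
    by (simp add: sum_product mult_single)
  finally have eq: "?l (sym_vec a * g) (?s i 1 + m) =
      (\<Sum>j\<in>UNIV. \<Sum>n\<in>?K. (a $ j * ?l g n when ?s j 1 + n = ?s i 1 + m))"
    by (simp add: lookup_sum lookup_single)
  have unique: "j = i \<and> n = m" if "n \<in> ?K" "?s j 1 + n = ?s i 1 + m" for j n
  proof -
    have "?l (?s j 1 + n) i = ?l (?s i 1 + m) i" using that by simp
    with m(2)[OF that(1)] have "j = i"
      by (auto simp: lookup_add lookup_single when_def split: if_splits)
    with that(2) show ?thesis by simp
  qed
  have "(a $ j * ?l g n when ?s j 1 + n = ?s i 1 + m) =
      (if j = i then if n = m then a $ i * ?l g m else 0 else 0)"
    if "n \<in> ?K" for j n
  proof (cases "j = i \<and> n = m")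
    case False
    then have "?s j 1 + n \<noteq> ?s i 1 + m" using unique[OF that] by blast
    then show ?thesis using False by (simp only: when_def) auto
  qed simp
  then have "?l (sym_vec a * g) (?s i 1 + m) =
      (\<Sum>j\<in>UNIV. \<Sum>n\<in>?K. if j = i then if n = m then a $ i * ?l g m else 0 else 0)"
    unfolding eq by simp
  also have "\<dots> = (\<Sum>n\<in>?K. if n = m then a $ i * ?l g m else 0)"
    by (subst sum.remove[of _ i]) auto
  also have "\<dots> = a $ i * ?l g m"
    using m(1) by simp
  finally show False
    using assms(2) i m(1) by (simp add: in_keys_iff)
qed

lemma sym_vec_mult_cancel:
  assumes "a \<noteq> 0" "sym_vec a * f = sym_vec a * g"
  shows "f = g"
  using sym_vec_mult_eq_0[OF assms(1), of "f - g"] assms(2) by (simp add: right_diff_distrib)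

lemma exact_div_sym_vec:
  assumes "a \<noteq> 0" "f = sym_vec a * q"
  shows "exact_div f (sym_vec a) = q"
  unfolding exact_div_def
proof (rule the_equality)
  show "q' = q" if "f = sym_vec a * q'" for q'
    by (rule sym_vec_mult_cancel[OF assms(1)]) (use that assms(2) in simp)
qed (rule assms(2))

text \<open>
  Projecting along \<open>a\<close> turns divisibility by \<open>a\<close> into vanishing: \<open>\<pi>\<close> kills \<open>a\<close>, is the identity
  modulo \<open>a\<close>, and sends \<open>b\<close> to a nonzero linear form, which is not a zero divisor.
\<close>
lemma sym_vec_prime:
  assumes a: "a \<noteq> 0" and b: "\<And>c. b \<noteq> c *s a" and dvd: "sym_vec a dvd sym_vec b * g"
  shows "sym_vec a dvd g"
proof -
  from a obtain i where i: "a $ i \<noteq> 0" by (auto simp: vec_eq_iff)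
  (* The projection along a onto the hyperplane where the i-th coordinate vanishes. *)
  define \<pi> where "\<pi> x = x - (x $ i / a $ i) *s a" for x
  have lin: "linear_map \<pi>"
    by (rule linear_mapI) (auto simp: \<pi>_def vec_eq_iff add_divide_distrib algebra_simps)
  have "\<pi> a = 0" using i by (simp add: \<pi>_def)
  have "\<pi> b \<noteq> 0" using b by (auto simp: \<pi>_def)
  from dvd obtain q where "sym_vec b * g = sym_vec a * q" by blast
  then have "sym_act \<pi> (sym_vec b * g) = sym_act \<pi> (sym_vec a * q)" by simp
  then have "sym_vec (\<pi> b) * sym_act \<pi> g = 0"
    by (simp add: sym_act_mult sym_act_vec[OF lin] \<open>\<pi> a = 0\<close>)
  then have "sym_act \<pi> g = 0" using \<open>\<pi> b \<noteq> 0\<close> sym_vec_mult_eq_0 by blast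
  moreover have "sym_vec a dvd g - sym_act \<pi> g"
    by (rule dvd_diff_sym_act) (simp add: \<pi>_def sym_vec_diff sym_vec_scale)
  ultimately show ?thesis by simp
qed

definition pairwise_independent :: "(complex^'n) set \<Rightarrow> bool" where
  "pairwise_independent S \<longleftrightarrow> 0 \<notin> S \<and> (\<forall>a\<in>S. \<forall>b\<in>S. a \<noteq> b \<longrightarrow> (\<forall>c. b \<noteq> c *s a))"

lemma sym_vec_prime_prod:
  assumes "finite S" "a \<noteq> 0" "\<And>b c. b \<in> S \<Longrightarrow> b \<noteq> c *s a"
    and "sym_vec a dvd (\<Prod>b\<in>S. sym_vec b) * g"
  shows "sym_vec a dvd g"
  using assms
proof (induction S)
  case (insert b S)
  have "sym_vec a dvd sym_vec b * ((\<Prod>b\<in>S. sym_vec b) * g)"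
    using insert.prems(3) insert.hyps by (simp add: mult.assoc)
  then have "sym_vec a dvd (\<Prod>b\<in>S. sym_vec b) * g"
    by (rule sym_vec_prime[rotated 2]) (use insert.prems in auto)
  then show ?case
    using insert.IH insert.prems(1,2) by blast
qed simp

lemma prod_sym_vec_dvd:
  assumes "finite S" "pairwise_independent S" "\<And>b. b \<in> S \<Longrightarrow> sym_vec b dvd f"
  shows "(\<Prod>b\<in>S. sym_vec b) dvd f"
  using assms
proof (induction S)
  case (insert a S)
  have ind: "pairwise_independent S" "a \<noteq> 0" "\<And>b c. b \<in> S \<Longrightarrow> b \<noteq> c *s a"
    using insert.prems(1) insert.hyps(2) unfolding pairwise_independent_def by (blast, blast, metis insertCI)
  have "(\<Prod>b\<in>S. sym_vec b) dvd f"
    by (rule insert.IH[OF ind(1)]) (rule insert.prems(2), rule insertI2)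
  then obtain g where g: "f = (\<Prod>b\<in>S. sym_vec b) * g" by (rule dvdE)
  have "sym_vec a dvd f" by (rule insert.prems(2)) simp
  then have "sym_vec a dvd g"
    unfolding g using sym_vec_prime_prod[OF insert.hyps(1) ind(2)] ind(3) by blast
  then obtain q where "g = sym_vec a * q" by (rule dvdE)
  then show ?case using g insert.hyps by (simp add: mult.commute mult.left_commute)
qed simp

section \<open>Homogeneity as an eigenvalue condition\<close>

text \<open>
  A polynomial is homogeneous of degree \<open>k\<close> exactly when doubling all variables multiplies it by
  \<open>2 ^ k\<close>.  In this form a degree can be lowered without first knowing that it is positive: division
  by a linear form halves the factor, and a factor of modulus below \<open>1\<close> leaves only the zero polynomial.
\<close>
definition scales_by :: "complex \<Rightarrow> 'n::finite sym \<Rightarrow> bool" where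
  "scales_by \<kappa> f \<longleftrightarrow> sym_act (\<lambda>x. 2 *s x) f = sym_const \<kappa> * f"

lemma linear_scale: "linear_map (\<lambda>x. c *s x)"
  by (rule linear_mapI) (auto simp: vec.scale_right_distrib)

lemma sym_const_power: "sym_const (a ^ k) = sym_const a ^ k"
  by (induction k) (auto simp: sym_const_mult)

lemma lookup_sym_act_scale:
  fixes f :: "'n::finite sym"
  shows "Poly_Mapping.lookup (sym_act (\<lambda>x. c *s x) f) m =
     c ^ (\<Sum>i\<in>UNIV. Poly_Mapping.lookup m i) * Poly_Mapping.lookup f m"
proof -
  have "(\<Prod>i\<in>UNIV. sym_vec (c *s axis i 1) ^ Poly_Mapping.lookup n i) =
      sym_const (c ^ (\<Sum>i\<in>UNIV. Poly_Mapping.lookup n i)) * Poly_Mapping.single n 1" for n :: "'n \<Rightarrow>\<^sub>0 nat"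
    by (simp add: sym_vec_scale power_mult_distrib prod.distrib prod_axes
        sym_const_power power_sum[of "sym_const c"])
  then have "sym_act (\<lambda>x. c *s x) f = (\<Sum>n\<in>Poly_Mapping.keys f. Poly_Mapping.single n
      (c ^ (\<Sum>i\<in>UNIV. Poly_Mapping.lookup n i) * Poly_Mapping.lookup f n))"
    by (simp add: sym_act_def sym_const_def mult_single mult.commute)
  then show ?thesis
    by (auto simp: lookup_sum lookup_single when_def in_keys_iff)
qed

lemma lookup_const_mult: "Poly_Mapping.lookup (sym_const c * f) m = c * Poly_Mapping.lookup f m"
proof -
  have "sym_const c * f = sym_const c * (\<Sum>n\<in>Poly_Mapping.keys f. Poly_Mapping.single n (Poly_Mapping.lookup f n))"
    by (simp add: sum_singles)
  also have "\<dots> = (\<Sum>n\<in>Poly_Mapping.keys f. Poly_Mapping.single n (c * Poly_Mapping.lookup f n))"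
    by (simp add: sum_distrib_left sym_const_def mult_single)
  finally show ?thesis
    by (auto simp: lookup_sum lookup_single when_def in_keys_iff)
qed

lemma scales_by_iff:
  "scales_by \<kappa> f \<longleftrightarrow> (\<forall>m\<in>Poly_Mapping.keys f. 2 ^ (\<Sum>i\<in>UNIV. Poly_Mapping.lookup m i) = \<kappa>)"
  unfolding scales_by_def
  by (auto simp: poly_mapping_eq_iff fun_eq_iff lookup_sym_act_scale lookup_const_mult in_keys_iff)

lemma sym_homogeneous_iff: "sym_homogeneous k f \<longleftrightarrow> scales_by (2 ^ k) f"
proof -
  have "(2::complex) ^ a = 2 ^ k \<longleftrightarrow> a = k" for a
  proof
    assume "(2::complex) ^ a = 2 ^ k"
    then have "norm ((2::complex) ^ a) = norm ((2::complex) ^ k)" by simp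
    then show "a = k" by (simp add: norm_power)
  qed simp
  then show ?thesis by (simp add: sym_homogeneous_def scales_by_iff)
qed

lemma scales_by_less_1:
  assumes "scales_by \<kappa> f" "norm \<kappa> < 1"
  shows "f = 0"
proof -
  have "1 \<le> norm ((2::complex) ^ k)" for k by (simp add: norm_power)
  then have "m \<notin> Poly_Mapping.keys f" for m
    using assms unfolding scales_by_iff by (metis linorder_not_less)
  then have "Poly_Mapping.keys f = {}" by blast
  then show ?thesis by simp
qed

lemma scales_by_unique:
  assumes "scales_by \<kappa> f" "scales_by \<mu> f" "f \<noteq> 0"
  shows "\<kappa> = \<mu>"
proof -
  from \<open>f \<noteq> 0\<close> obtain m where "m \<in> Poly_Mapping.keys f" by (metis keys_eq_empty equals0I)
  then show ?thesis using assms by (auto simp: scales_by_iff)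
qed

lemma scales_by_0 [simp]: "scales_by \<kappa> 0"
  by (simp add: scales_by_def)

lemma scales_by_1: "scales_by 1 1"
  by (simp add: scales_by_def)

lemma scales_by_diff: "scales_by \<kappa> f \<Longrightarrow> scales_by \<kappa> g \<Longrightarrow> scales_by \<kappa> (f - g)"
  by (simp add: scales_by_def sym_act_diff algebra_simps)

lemma scales_by_mult: "scales_by \<kappa> f \<Longrightarrow> scales_by \<mu> g \<Longrightarrow> scales_by (\<kappa> * \<mu>) (f * g)"
  by (simp add: scales_by_def sym_act_mult sym_const_mult algebra_simps)

lemma scales_by_sym_vec: "scales_by 2 (sym_vec a)"
  by (simp add: scales_by_def sym_act_vec[OF linear_scale] sym_vec_scale)

lemma scales_by_prod: "finite S \<Longrightarrow> scales_by (2 ^ card S) (\<Prod>b\<in>S. sym_vec b)"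
  by (induction S rule: finite_induct) (auto simp: scales_by_1 intro: scales_by_mult scales_by_sym_vec)

lemma scales_by_sym_act:
  assumes "linear_map w" "scales_by \<kappa> f"
  shows "scales_by \<kappa> (sym_act w f)"
proof -
  interpret w: Vector_Spaces.linear "(*s)" "(*s)" w by fact
  have "sym_act (\<lambda>x. 2 *s x) (sym_act w f) = sym_act w (sym_act (\<lambda>x. 2 *s x) f)"
    by (simp add: sym_act_comp[OF linear_scale] sym_act_comp[OF assms(1)] comp_def w.scale)
  also have "\<dots> = sym_const \<kappa> * sym_act w f"
    using assms(2) by (simp add: scales_by_def sym_act_mult)
  finally show ?thesis by (simp add: scales_by_def)
qed

lemma scales_by_divide:
  assumes "a \<noteq> 0" "scales_by \<kappa> (sym_vec a * g)"
  shows "scales_by (\<kappa> / 2) g"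
proof -
  have "sym_vec a * (sym_const 2 * sym_act (\<lambda>x. 2 *s x) g) = sym_vec a * (sym_const \<kappa> * g)"
    using assms(2) by (simp add: scales_by_def sym_act_mult sym_act_vec[OF linear_scale]
        sym_vec_scale algebra_simps)
  then have "sym_const 2 * sym_act (\<lambda>x. 2 *s x) g = sym_const \<kappa> * g"
    by (rule sym_vec_mult_cancel[OF assms(1)])
  then have "sym_const (1/2) * (sym_const 2 * sym_act (\<lambda>x. 2 *s x) g) = sym_const (1/2) * (sym_const \<kappa> * g)"
    by simp
  then show ?thesis
    by (simp add: scales_by_def mult.assoc[symmetric] sym_const_mult[symmetric])
qed

lemma scales_by_divide_prod:
  assumes "finite S" "0 \<notin> S" "scales_by \<kappa> ((\<Prod>b\<in>S. sym_vec b) * g)"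
  shows "scales_by (\<kappa> / 2 ^ card S) g"
  using assms
proof (induction S arbitrary: \<kappa>)
  case (insert a S)
  then have "scales_by (\<kappa> / 2) ((\<Prod>b\<in>S. sym_vec b) * g)"
    by (intro scales_by_divide[of a]) (auto simp: mult.assoc)
  then have "scales_by (\<kappa> / 2 / 2 ^ card S) g"
    using insert.IH[of "\<kappa> / 2"] insert.prems(1) by blast
  moreover have "\<kappa> / 2 / 2 ^ card S = \<kappa> / 2 ^ card (insert a S)" using insert by simp
  ultimately show ?case by (simp only:)
qed auto

section \<open>Positive polynomials\<close>

text \<open>
  Sums and products here are nonempty, apart from the product \<open>1\<close>; thus \<open>0\<close> is left out, and membership
  certifies nonvanishing.
\<close>
inductive_set sums_of_products :: "(complex^'n::finite) set \<Rightarrow> 'n sym set" for S where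
  one: "1 \<in> sums_of_products S"
| vec: "b \<in> S \<Longrightarrow> sym_vec b \<in> sums_of_products S"
| add: "f \<in> sums_of_products S \<Longrightarrow> g \<in> sums_of_products S \<Longrightarrow> f + g \<in> sums_of_products S"
| mult: "f \<in> sums_of_products S \<Longrightarrow> g \<in> sums_of_products S \<Longrightarrow> f * g \<in> sums_of_products S"

lemma sums_of_products_mono:
  assumes "S \<subseteq> T" shows "f \<in> sums_of_products S \<Longrightarrow> f \<in> sums_of_products T"
  by (induction rule: sums_of_products.induct) (use assms in \<open>auto intro: sums_of_products.intros\<close>)

lemma sym_act_sums_of_products:
  assumes "linear_map w"
  shows "f \<in> sums_of_products S \<Longrightarrow> sym_act w f \<in> sums_of_products (w ` S)"
  by (induction rule: sums_of_products.induct)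
    (auto simp: sym_act_add sym_act_mult sym_act_vec[OF assms] intro: sums_of_products.intros)

text \<open>
  Such a polynomial is positive at the point of \<open>\<tt>\<close> given by \<open>L\<close>.
\<close>
lemma sums_of_products_nonzero:
  fixes L :: "complex^'n::finite \<Rightarrow> complex"
  assumes lin: "Vector_Spaces.linear (*s) (*) L"
    and pos: "\<And>b. b \<in> S \<Longrightarrow> \<exists>r>0. L b = of_real r"
    and f: "f \<in> sums_of_products S"
  shows "f \<noteq> 0"
proof -
  interpret L: Vector_Spaces.linear "(*s)" "(*)" L by fact
  let ?ev = "insertion (\<lambda>a. a) (\<lambda>i. L (axis i 1))"
  have vec: "?ev (sym_vec x) = L x" for x
  proof -
    have "L x = L (\<Sum>i\<in>UNIV. x $ i *s axis i 1)" by (simp add: basis_expansion)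
    then show ?thesis by (simp add: evaluation.insertion_vec L.sum L.scale)
  qed
  from f have "\<exists>r>0. ?ev f = complex_of_real r"
  proof (induction rule: sums_of_products.induct)
    case one
    then show ?case by (auto intro!: exI[of _ 1])
  next
    case (vec b)
    then show ?case using pos by (simp add: \<open>\<And>x. ?ev (sym_vec x) = L x\<close>)
  next
    case (add f g)
    then obtain r s where "r > 0" "s > 0" "?ev f = complex_of_real r" "?ev g = complex_of_real s" by auto
    then show ?case by (intro exI[of _ "r + s"]) (simp add: evaluation.insertion_add)
  next
    case (mult f g)
    then obtain r s where "r > 0" "s > 0" "?ev f = complex_of_real r" "?ev g = complex_of_real s" by auto
    then show ?case by (intro exI[of _ "r * s"]) (simp add: evaluation.insertion_mult)
  qed
  then show ?thesis by auto
qed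

section \<open>Root systems\<close>

lemma generated_base: "s \<in> S \<Longrightarrow> s \<in> generated S"
  using generated_comp[OF _ generated_id, of s S] by simp

lemma generated_mult: "u \<in> generated S \<Longrightarrow> v \<in> generated S \<Longrightarrow> u \<circ> v \<in> generated S"
  by (induction rule: generated.induct) (auto simp: comp_assoc intro: generated_comp)

lemma generated_mono:
  assumes "S \<subseteq> T"
  shows "w \<in> generated S \<Longrightarrow> w \<in> generated T"
  by (induction rule: generated.induct) (use assms in \<open>blast intro: generated.intros\<close>)+

lemma generated_bij_inv:
  assumes "\<And>s. s \<in> S \<Longrightarrow> s \<circ> s = id"
  shows "w \<in> generated S \<Longrightarrow> bij w \<and> inv w \<in> generated S"
proof (induction rule: generated.induct)
  case (generated_comp s w)
  have "bij s" using assms[OF generated_comp(1)] by (rule o_bij) (fact assms[OF generated_comp(1)])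
  moreover have "inv s = s" using assms[OF generated_comp(1)] by (simp add: inv_unique_comp)
  moreover have "s \<in> generated S" by (rule generated_base) (fact generated_comp(1))
  ultimately show "bij (s \<circ> w) \<and> inv (s \<circ> w) \<in> generated S"
    using generated_comp by (simp add: o_inv_distrib bij_comp generated_mult)
next
  case generated_id
  show "bij id \<and> inv id \<in> generated S" by (simp add: generated.generated_id)
qed

locale root_system =
  fixes R :: "'n::finite root_data"
  assumes semisimple: "semisimple_root_data R"
begin

abbreviation "\<Phi> \<equiv> roots R"
abbreviation "Pos \<equiv> pos_roots R"
abbreviation "\<alpha> \<equiv> simple R"
abbreviation "s \<equiv> reflection R"
abbreviation "W \<equiv> weyl_group R"
abbreviation "len \<equiv> weyl_length R"

lemma finite_roots: "finite \<Phi>"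
  and span_roots: "vec.span \<Phi> = UNIV"
  and root_nonzero: "0 \<notin> \<Phi>"
  and linear_coroot: "\<beta> \<in> \<Phi> \<Longrightarrow> Vector_Spaces.linear (*s) (*) (coroot R \<beta>)"
  and coroot_self: "\<beta> \<in> \<Phi> \<Longrightarrow> coroot R \<beta> \<beta> = 2"
  and reflection_root: "\<beta> \<in> \<Phi> \<Longrightarrow> \<gamma> \<in> \<Phi> \<Longrightarrow> s \<beta> \<gamma> \<in> \<Phi>"
  and root_multiple: "\<beta> \<in> \<Phi> \<Longrightarrow> c *s \<beta> \<in> \<Phi> \<Longrightarrow> c = 1 \<or> c = - 1"
  and simple_root: "\<alpha> i \<in> \<Phi>"
  and inj_simple: "inj \<alpha>"
  and independent_simple: "vec.independent (range \<alpha>)"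
  and roots_eq: "\<Phi> = Pos \<union> neg_roots R"
  using semisimple
  unfolding semisimple_root_data_def reduced_root_system_def is_base_def by blast+

lemma coroot_add: "\<beta> \<in> \<Phi> \<Longrightarrow> coroot R \<beta> (x + y) = coroot R \<beta> x + coroot R \<beta> y"
  and coroot_scale: "\<beta> \<in> \<Phi> \<Longrightarrow> coroot R \<beta> (c *s x) = c * coroot R \<beta> x"
  using linear_coroot[unfolded Vector_Spaces.linear_iff] by auto

lemma coroot_diff: "\<beta> \<in> \<Phi> \<Longrightarrow> coroot R \<beta> (x - y) = coroot R \<beta> x - coroot R \<beta> y"
  using coroot_add[of \<beta> "x - y" y] by simp

lemma linear_reflection: "\<beta> \<in> \<Phi> \<Longrightarrow> linear_map (s \<beta>)"
  by (rule linear_mapI)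
    (auto simp: reflection_def coroot_add coroot_scale vec.scale_left_distrib vec.scale_right_diff_distrib)

lemma reflection_self: "\<beta> \<in> \<Phi> \<Longrightarrow> s \<beta> \<beta> = - \<beta>"
  by (simp add: reflection_def coroot_self vec_eq_iff)

lemma reflection_reflection [simp]: "\<beta> \<in> \<Phi> \<Longrightarrow> s \<beta> (s \<beta> x) = x"
  by (simp add: reflection_def coroot_diff coroot_scale coroot_self vec_eq_iff)

lemma reflection_involution: "\<beta> \<in> \<Phi> \<Longrightarrow> s \<beta> \<circ> s \<beta> = id"
  by (simp add: fun_eq_iff)

lemma inv_reflection [simp]: "\<beta> \<in> \<Phi> \<Longrightarrow> inv (s \<beta>) = s \<beta>"
  by (simp add: inv_unique_comp reflection_involution)

lemma pos_root: "\<beta> \<in> Pos \<Longrightarrow> \<beta> \<in> \<Phi>"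
  by (simp add: pos_roots_def)

lemma neg_roots_iff: "\<beta> \<in> neg_roots R \<longleftrightarrow> - \<beta> \<in> Pos"
  unfolding neg_roots_def by force

definition coeff :: "'n \<Rightarrow> complex^'n \<Rightarrow> complex" where
  "coeff i x = vec.representation (range \<alpha>) x (\<alpha> i)"

lemma span_simple: "vec.span (range \<alpha>) = UNIV"
proof -
  have "(\<Sum>i\<in>UNIV. of_nat (m i) *s \<alpha> i) \<in> vec.span (range \<alpha>)" for m :: "'n \<Rightarrow> nat"
    by (rule vec.span_sum, rule vec.span_scale, rule vec.span_base) simp
  then have pos: "Pos \<subseteq> vec.span (range \<alpha>)"
    by (auto simp: pos_roots_def)
  moreover from pos have "neg_roots R \<subseteq> vec.span (range \<alpha>)"
    by (auto simp: neg_roots_def intro: vec.span_neg)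
  ultimately have "\<Phi> \<subseteq> vec.span (range \<alpha>)"
    using roots_eq by blast
  then have "vec.span \<Phi> \<subseteq> vec.span (range \<alpha>)"
    by (rule vec.span_minimal) (rule vec.subspace_span)
  then show ?thesis using span_roots by auto
qed

lemma coeff_add: "coeff i (x + y) = coeff i x + coeff i y"
  by (simp add: coeff_def vec.representation_add[OF independent_simple] span_simple)

lemma coeff_scale: "coeff i (c *s x) = c * coeff i x"
  by (simp add: coeff_def vec.representation_scale[OF independent_simple] span_simple)

lemma coeff_uminus: "coeff i (- x) = - coeff i x"
  using coeff_scale[of i "-1" x] by (simp add: vec_eq_iff)

lemma coeff_0 [simp]: "coeff i 0 = 0"
  using coeff_scale[of i 0 0] by simp

lemma coeff_diff: "coeff i (x - y) = coeff i x - coeff i y"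
  using coeff_add[of i x "- y"] by (simp add: coeff_uminus)

lemma coeff_sum: "coeff i (sum F I) = (\<Sum>j\<in>I. coeff i (F j))"
  by (induction I rule: infinite_finite_induct) (auto simp: coeff_add)

lemma coeff_simple: "coeff i (\<alpha> j) = (if i = j then 1 else 0)"
  using inj_simple by (simp add: coeff_def vec.representation_basis[OF independent_simple] inj_eq)

lemma simple_expansion: "(\<Sum>i\<in>UNIV. coeff i x *s \<alpha> i) = x"
proof -
  have "(\<Sum>b\<in>range \<alpha>. vec.representation (range \<alpha>) x b *s b) = x"
    by (rule vec.sum_representation_eq[OF independent_simple]) (auto simp: span_simple)
  then show ?thesis
    by (simp add: sum.reindex[OF inj_simple] coeff_def)
qed

lemma coeff_eqI:
  assumes "\<And>i. coeff i x = coeff i y"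
  shows "x = y"
proof -
  have "x = (\<Sum>i\<in>UNIV. coeff i x *s \<alpha> i)" by (rule simple_expansion[symmetric])
  also have "\<dots> = (\<Sum>i\<in>UNIV. coeff i y *s \<alpha> i)" using assms by simp
  also have "\<dots> = y" by (rule simple_expansion)
  finally show ?thesis .
qed

lemma pos_roots_iff: "\<beta> \<in> Pos \<longleftrightarrow> \<beta> \<in> \<Phi> \<and> (\<forall>i. coeff i \<beta> \<in> \<nat>)"
proof
  assume "\<beta> \<in> Pos"
  then obtain m :: "'n \<Rightarrow> nat" where m: "\<beta> \<in> \<Phi>" "\<beta> = (\<Sum>i\<in>UNIV. of_nat (m i) *s \<alpha> i)"
    by (auto simp: pos_roots_def)
  have "coeff i \<beta> = of_nat (m i)" for i
    unfolding m(2)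
    by (simp add: coeff_sum coeff_scale coeff_simple if_distrib[of "\<lambda>c. _ * c"] cong: if_cong)
  then show "\<beta> \<in> \<Phi> \<and> (\<forall>i. coeff i \<beta> \<in> \<nat>)" using m(1) by auto
next
  assume *: "\<beta> \<in> \<Phi> \<and> (\<forall>i. coeff i \<beta> \<in> \<nat>)"
  then have "\<forall>i. \<exists>k::nat. coeff i \<beta> = of_nat k" by (auto elim: Nats_cases)
  then obtain m :: "'n \<Rightarrow> nat" where "\<And>i. coeff i \<beta> = of_nat (m i)" by metis
  then have "\<beta> = (\<Sum>i\<in>UNIV. of_nat (m i) *s \<alpha> i)"
    using simple_expansion[of \<beta>] by simp
  then show "\<beta> \<in> Pos" using * unfolding pos_roots_def by blast
qed

lemma pos_or_neg: "\<beta> \<in> \<Phi> \<Longrightarrow> \<beta> \<in> Pos \<or> - \<beta> \<in> Pos"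
  using roots_eq neg_roots_iff by blast

lemma pos_coeff_Re: "\<beta> \<in> Pos \<Longrightarrow> 0 \<le> Re (coeff i \<beta>)"
  by (auto simp: pos_roots_iff elim!: Nats_cases dest!: spec[of _ i])

lemma pos_not_neg: "\<beta> \<in> Pos \<Longrightarrow> - \<beta> \<notin> Pos"
proof
  assume pos: "\<beta> \<in> Pos" and neg: "- \<beta> \<in> Pos"
  have "coeff i \<beta> = 0" for i
    using pos neg by (auto simp: pos_roots_iff coeff_uminus complex_eq_iff elim!: Nats_cases dest!: spec[of _ i])
  then have "\<beta> = 0" by (intro coeff_eqI) simp
  then show False using pos pos_root root_nonzero by blast
qed

lemma neg_iff_not_pos: "\<beta> \<in> \<Phi> \<Longrightarrow> \<beta> \<in> neg_roots R \<longleftrightarrow> \<beta> \<notin> Pos"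
  using pos_or_neg pos_not_neg neg_roots_iff by auto

lemma uminus_pos_iff: "\<beta> \<in> \<Phi> \<Longrightarrow> - \<beta> \<in> Pos \<longleftrightarrow> \<beta> \<notin> Pos"
  using neg_iff_not_pos neg_roots_iff by auto

lemma posI_coeff:
  assumes "\<beta> \<in> \<Phi>" "0 < Re (coeff i \<beta>)"
  shows "\<beta> \<in> Pos"
  using pos_or_neg[OF assms(1)] pos_coeff_Re[of "- \<beta>" i] assms(2) by (auto simp: coeff_uminus)

lemma simple_pos: "\<alpha> i \<in> Pos"
  by (auto simp: pos_roots_iff simple_root coeff_simple)

lemma coeff_reflection: "coeff j (s (\<alpha> i) x) = coeff j x - (if i = j then coroot R (\<alpha> i) x else 0)"
  by (auto simp: reflection_def coeff_diff coeff_scale coeff_simple)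

lemma pos_coeff_nonzero:
  assumes "\<beta> \<in> Pos" "\<beta> \<noteq> \<alpha> i"
  shows "\<exists>j. j \<noteq> i \<and> 0 < Re (coeff j \<beta>)"
proof (rule ccontr)
  assume *: "\<not> ?thesis"
  have "coeff j \<beta> = 0" if "j \<noteq> i" for j
    using * that assms(1) pos_coeff_Re[OF assms(1), of j]
    by (auto simp: pos_roots_iff elim!: Nats_cases dest!: spec[of _ j])
  then have "\<beta> = coeff i \<beta> *s \<alpha> i"
    by (intro coeff_eqI) (auto simp: coeff_scale coeff_simple)
  then have "coeff i \<beta> = 1 \<or> coeff i \<beta> = - 1"
    using root_multiple[OF simple_root] pos_root[OF assms(1)] by metis
  moreover have "coeff i \<beta> \<noteq> -1" using pos_coeff_Re[OF assms(1), of i] by auto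
  ultimately show False using assms(2) \<open>\<beta> = coeff i \<beta> *s \<alpha> i\<close> by simp
qed

text \<open>
  A positive root other than \<open>\<alpha>\<^sub>i\<close> involves some other simple root, because the system is reduced; the
  reflection does not change that coefficient, and one positive coefficient makes a root positive.
\<close>
lemma simple_reflection_pos:
  assumes "\<beta> \<in> Pos" "\<beta> \<noteq> \<alpha> i"
  shows "s (\<alpha> i) \<beta> \<in> Pos"
proof -
  obtain j where "j \<noteq> i" "0 < Re (coeff j \<beta>)" using pos_coeff_nonzero[OF assms] by blast
  then show ?thesis
    using assms(1) by (intro posI_coeff[of _ j])
      (auto simp: coeff_reflection pos_root reflection_root simple_root)
qed

lemma simple_reflection_neq:
  assumes "\<beta> \<in> Pos"
  shows "s (\<alpha> i) \<beta> \<noteq> \<alpha> i"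
proof
  assume "s (\<alpha> i) \<beta> = \<alpha> i"
  then have "\<beta> = s (\<alpha> i) (\<alpha> i)" by (metis reflection_reflection simple_root)
  then show False using assms simple_pos pos_not_neg by (simp add: reflection_self simple_root)
qed

section \<open>The Weyl group is generated by simple reflections\<close>

lemma reflection_in_W: "\<beta> \<in> \<Phi> \<Longrightarrow> s \<beta> \<in> W"
  by (auto simp: weyl_group_def intro: generated_base)

lemma simple_in_W: "s (\<alpha> i) \<in> W"
  by (simp add: reflection_in_W simple_root)

lemma id_in_W: "id \<in> W"
  by (simp add: weyl_group_def generated_id)

lemma W_mult: "u \<in> W \<Longrightarrow> v \<in> W \<Longrightarrow> u \<circ> v \<in> W"
  by (simp add: weyl_group_def generated_mult)

lemma W_bij_inv: "w \<in> W \<Longrightarrow> bij w \<and> inv w \<in> W"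
  unfolding weyl_group_def by (rule generated_bij_inv) (auto simp: reflection_involution)

lemmas W_bij = W_bij_inv[THEN conjunct1] and W_inv = W_bij_inv[THEN conjunct2]

lemma inv_W_apply [simp]: "w \<in> W \<Longrightarrow> inv w (w x) = x" and W_inv_apply [simp]: "w \<in> W \<Longrightarrow> w (inv w x) = x"
  using W_bij[of w] by (auto simp: bij_is_inj bij_is_surj surj_f_inv_f)

lemma inv_inv_W [simp]: "w \<in> W \<Longrightarrow> inv (inv w) = w"
  by (simp add: W_bij inv_inv_eq)

lemma inv_comp_W: "u \<in> W \<Longrightarrow> v \<in> W \<Longrightarrow> inv (u \<circ> v) = inv v \<circ> inv u"
  by (simp add: W_bij o_inv_distrib)

lemma W_induct [consumes 1, case_names id comp]:
  assumes "w \<in> W" "P id" "\<And>\<beta> w. \<beta> \<in> \<Phi> \<Longrightarrow> w \<in> W \<Longrightarrow> P w \<Longrightarrow> P (s \<beta> \<circ> w)"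
  shows "P w"
  using assms(1) unfolding weyl_group_def
proof (induction rule: generated.induct)
  case generated_id
  show "P id" by (rule assms(2))
next
  case (generated_comp t w)
  then obtain \<beta> where "\<beta> \<in> \<Phi>" "t = s \<beta>" by auto
  then show "P (t \<circ> w)" using generated_comp assms(3) by (simp add: weyl_group_def)
qed

lemma W_linear: "w \<in> W \<Longrightarrow> linear_map w"
proof (induction rule: W_induct)
  case id
  show "linear_map id" by (rule linear_mapI) auto
next
  case (comp \<beta> w)
  show "linear_map (s \<beta> \<circ> w)"
    using comp linear_reflection by (blast intro: Vector_Spaces.linear_compose)
qed

lemma W_root: "w \<in> W \<Longrightarrow> \<beta> \<in> \<Phi> \<Longrightarrow> w \<beta> \<in> \<Phi>"
  by (induction rule: W_induct) (auto simp: reflection_root)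

lemma W_uminus: "w \<in> W \<Longrightarrow> w (- x) = - w x"
  and W_add: "w \<in> W \<Longrightarrow> w (x + y) = w x + w y"
  and W_diff: "w \<in> W \<Longrightarrow> w (x - y) = w x - w y"
  and W_scale: "w \<in> W \<Longrightarrow> w (c *s x) = c *s w x"
  and W_sum: "w \<in> W \<Longrightarrow> w (sum F I) = (\<Sum>i\<in>I. w (F i))"
proof -
  assume "w \<in> W"
  then interpret w: Vector_Spaces.linear "(*s)" "(*s)" w by (rule W_linear)
  show "w (- x) = - w x" "w (x + y) = w x + w y" "w (x - y) = w x - w y" "w (c *s x) = c *s w x"
    "w (sum F I) = (\<Sum>i\<in>I. w (F i))"
    by (rule w.neg w.add w.diff w.scale w.sum)+
qed

text \<open>
  The Weyl group acts faithfully on the roots, as they span.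
\<close>
lemma W_eqI:
  assumes "u \<in> W" "v \<in> W" "\<And>\<beta>. \<beta> \<in> \<Phi> \<Longrightarrow> u \<beta> = v \<beta>"
  shows "u = v"
proof
  fix x
  have "vec.subspace {x. u x = v x}"
    using assms(1,2) W_scale[of u 0] W_scale[of v 0] by (auto simp: vec.subspace_def W_add W_scale)
  then show "u x = v x"
    using vec.span_induct[of x \<Phi> "\<lambda>x. u x = v x"] span_roots assms(3) by auto
qed

lemma finite_W: "finite W"
proof (rule inj_on_finite)
  show "inj_on (\<lambda>w. restrict w \<Phi>) W"
  proof (rule inj_onI)
    fix u v assume uv: "u \<in> W" "v \<in> W" "restrict u \<Phi> = restrict v \<Phi>"
    then have "u \<beta> = v \<beta>" if "\<beta> \<in> \<Phi>" for \<beta> using that by (metis restrict_apply')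
    then show "u = v" by (rule W_eqI[OF uv(1,2)])
  qed
  show "(\<lambda>w. restrict w \<Phi>) ` W \<subseteq> \<Phi> \<rightarrow>\<^sub>E \<Phi>"
    using W_root by auto
  show "finite (\<Phi> \<rightarrow>\<^sub>E \<Phi>)"
    by (intro finite_PiE finite_roots)
qed

text \<open>
  A reflection is determined by its root.  Both sides negate \<open>w \<beta>\<close>, so they differ by a transvection
  \<open>x \<mapsto> x + \<theta> x \<gamma>\<close> with \<open>\<gamma> = w \<beta>\<close> and \<open>\<theta> \<gamma> = 0\<close>.  It preserves the roots; were \<open>\<theta> x \<noteq> 0\<close> for a root \<open>x\<close>, its
  iterates would produce infinitely many roots.
\<close>
lemma reflection_image:
  assumes w: "w \<in> W" and \<beta>: "\<beta> \<in> \<Phi>"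
  shows "s (w \<beta>) = w \<circ> s \<beta> \<circ> inv w"
proof -
  define \<gamma> where "\<gamma> = w \<beta>"
  define \<theta> where "\<theta> x = coroot R \<beta> (inv w x) - coroot R \<gamma> x" for x
  have \<gamma>: "\<gamma> \<in> \<Phi>" using assms W_root by (simp add: \<gamma>_def)
  have conj: "(w \<circ> s \<beta> \<circ> inv w) x = x - coroot R \<beta> (inv w x) *s \<gamma>" for x
    using w by (simp add: reflection_def W_diff W_scale \<gamma>_def)
  define t where "t = s \<gamma> \<circ> (w \<circ> s \<beta> \<circ> inv w)"
  have t: "t x = x + \<theta> x *s \<gamma>" for x
    unfolding t_def comp_def[of "s \<gamma>"] conj
    by (simp add: reflection_def coroot_diff coroot_scale coroot_self \<gamma> \<theta>_def vec_eq_iff algebra_simps)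
  have "t \<in> W" unfolding t_def by (intro W_mult reflection_in_W W_inv w \<beta> \<gamma>)
  have \<theta>_add: "\<theta> (x + y) = \<theta> x + \<theta> y" and \<theta>_scale: "\<theta> (c *s x) = c * \<theta> x" for x y c
    using w \<beta> \<gamma> by (simp_all add: \<theta>_def W_add W_scale W_inv coroot_add coroot_scale algebra_simps)
  have \<theta>_\<gamma>: "\<theta> \<gamma> = 0"
    using \<gamma> by (simp add: \<theta>_def coroot_self) (simp add: \<gamma>_def w \<beta> coroot_self)
  have "\<theta> x = 0" if x: "x \<in> \<Phi>" for x
  proof (rule ccontr)
    assume "\<theta> x \<noteq> 0"
    have iter: "x + (of_nat k * \<theta> x) *s \<gamma> \<in> \<Phi>" for k
    proof (induction k)
      case (Suc k)
      have "t (x + (of_nat k * \<theta> x) *s \<gamma>) = x + (of_nat (Suc k) * \<theta> x) *s \<gamma>"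
        by (simp add: t \<theta>_add \<theta>_scale \<theta>_\<gamma> vec_eq_iff algebra_simps)
      then show ?case using W_root[OF \<open>t \<in> W\<close> Suc] by simp
    qed (simp add: x)
    have "inj (\<lambda>k::nat. x + (of_nat k * \<theta> x) *s \<gamma>)"
      using \<gamma> root_nonzero \<open>\<theta> x \<noteq> 0\<close> by (auto intro!: injI)
    then have "infinite (range (\<lambda>k::nat. x + (of_nat k * \<theta> x) *s \<gamma>))"
      by (rule range_inj_infinite)
    moreover have "range (\<lambda>k::nat. x + (of_nat k * \<theta> x) *s \<gamma>) \<subseteq> \<Phi>" using iter by auto
    ultimately show False using finite_roots finite_subset by blast
  qed
  moreover have "vec.subspace {x. \<theta> x = 0}"
    using \<theta>_scale[of 0 0] by (auto simp: vec.subspace_def \<theta>_add \<theta>_scale)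
  ultimately have "\<theta> x = 0" for x
    using vec.span_induct[of x \<Phi> "\<lambda>x. \<theta> x = 0"] span_roots by auto
  then show ?thesis
    unfolding \<gamma>_def[symmetric] fun_eq_iff conj by (simp add: \<theta>_def reflection_def)
qed

lemma reflection_comp:
  assumes "w \<in> W" "\<beta> \<in> \<Phi>"
  shows "s (w \<beta>) \<circ> w = w \<circ> s \<beta>"
  using assms by (simp add: reflection_image fun_eq_iff)

lemma reflection_uminus: "\<beta> \<in> \<Phi> \<Longrightarrow> s (- \<beta>) = s \<beta>"
  using reflection_image[of "s \<beta>" \<beta>]
  by (simp add: reflection_in_W reflection_self fun_eq_iff)

text \<open>
  Let \<open>G\<close> be the finite group generated by the simple reflections and sum over it:
  \<open>av x = (\<Sum>w\<in>G. w x)\<close>.  From \<open>av (s\<^sub>i x) = av x\<close> follows \<open>av \<alpha>\<^sub>i = - av \<alpha>\<^sub>i = 0\<close>, hence \<open>av = 0\<close>.  If no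
  element of \<open>G\<close> took \<open>\<beta>\<close> to a simple root, the whole orbit of \<open>\<beta>\<close> would stay positive and \<open>av \<beta>\<close>
  would be nonzero.
\<close>
lemma pos_root_conjugate_simple:
  assumes "\<beta> \<in> Pos"
  shows "\<exists>w\<in>generated (range (\<lambda>i. s (\<alpha> i))). \<exists>i. w \<beta> = \<alpha> i"
proof (rule ccontr)
  assume none: "\<not> ?thesis"
  let ?G = "generated (range (\<lambda>i. s (\<alpha> i)))"
  have sub: "?G \<subseteq> W" unfolding weyl_group_def using simple_root by (auto intro: generated_mono[rotated])
  then have fin: "finite ?G" using finite_W finite_subset by blast
  have pos: "w \<in> ?G \<Longrightarrow> w \<beta> \<in> Pos" for w
  proof (induction rule: generated.induct)
    case (generated_comp t w)
    then show ?case using none simple_reflection_pos by auto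
  qed (simp add: assms)
  define av where "av x = (\<Sum>w\<in>?G. w x)" for x
  have av_simple: "av (\<alpha> i) = 0" for i
  proof -
    have gen: "s (\<alpha> i) \<in> ?G" by (auto intro: generated_base)
    have "bij_betw (\<lambda>w. w \<circ> s (\<alpha> i)) ?G ?G"
      by (rule bij_betw_byWitness[where f' = "\<lambda>w. w \<circ> s (\<alpha> i)"])
        (auto simp: comp_assoc reflection_involution simple_root intro: generated_mult gen)
    then have "av (\<alpha> i) = (\<Sum>w\<in>?G. (w \<circ> s (\<alpha> i)) (\<alpha> i))"
      unfolding av_def using sum.reindex_bij_betw[of "\<lambda>w. w \<circ> s (\<alpha> i)" ?G ?G "\<lambda>w. w (\<alpha> i)"] by metis
    also have "\<dots> = (\<Sum>w\<in>?G. - w (\<alpha> i))"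
      using sub by (intro sum.cong) (auto simp: reflection_self simple_root W_uminus)
    also have "\<dots> = - av (\<alpha> i)" by (simp add: av_def sum_negf)
    finally show ?thesis by (simp add: vec_eq_iff)
  qed
  have "av \<beta> = av (\<Sum>i\<in>UNIV. coeff i \<beta> *s \<alpha> i)" by (simp add: simple_expansion)
  also have "\<dots> = (\<Sum>w\<in>?G. \<Sum>i\<in>UNIV. coeff i \<beta> *s w (\<alpha> i))"
    unfolding av_def using sub by (intro sum.cong) (auto simp: W_sum W_scale)
  also have "\<dots> = (\<Sum>i\<in>UNIV. coeff i \<beta> *s av (\<alpha> i))"
    unfolding av_def by (subst sum.swap) (simp add: vec.scale_sum_right)
  finally have "av \<beta> = 0" by (simp add: av_simple)
  obtain i where i: "0 < Re (coeff i \<beta>)"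
    using pos_coeff_nonzero[OF assms, of i] none
    by (metis generated_id id_apply pos_coeff_nonzero[OF assms])
  have "0 < (\<Sum>w\<in>?G. Re (coeff i (w \<beta>)))"
    by (rule sum_pos2[OF fin generated_id]) (use i pos pos_coeff_Re in auto)
  also have "\<dots> = Re (coeff i (av \<beta>))" by (simp add: av_def coeff_sum)
  finally show False by (simp add: \<open>av \<beta> = 0\<close>)
qed

lemma W_generated_by_simple: "W = generated (range (\<lambda>i. s (\<alpha> i)))"
proof
  let ?G = "generated (range (\<lambda>i. s (\<alpha> i)))"
  show sub: "?G \<subseteq> W" unfolding weyl_group_def using simple_root by (auto intro: generated_mono[rotated])
  have pos: "s \<beta> \<in> ?G" if \<beta>: "\<beta> \<in> Pos" for \<beta>
  proof -
    obtain w i where w: "w \<in> ?G" "w \<beta> = \<alpha> i" using pos_root_conjugate_simple[OF \<beta>] by blast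
    have "inv w \<in> ?G"
      by (rule conjunct2[OF generated_bij_inv[OF _ w(1)]]) (auto simp: reflection_involution simple_root)
    have "w \<in> W" using sub w(1) by blast
    then have "\<beta> = inv w (\<alpha> i)" using w(2) by (metis inv_W_apply)
    then have "s \<beta> = inv w \<circ> s (\<alpha> i) \<circ> w"
      using reflection_image[of "inv w" "\<alpha> i"] \<open>w \<in> W\<close> by (simp add: W_inv simple_root)
    then show ?thesis using \<open>inv w \<in> ?G\<close> w(1)
      by (auto intro!: generated_mult intro: generated_base)
  qed
  have refl: "s \<beta> \<in> ?G" if "\<beta> \<in> \<Phi>" for \<beta>
    using pos_or_neg[OF that] pos reflection_uminus[OF that] by metis
  have "w \<in> ?G" if "w \<in> W" for w
    using that
  proof (induction rule: W_induct)
    case id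
    show "id \<in> ?G" by (rule generated_id)
  next
    case (comp \<beta> w)
    then show "s \<beta> \<circ> w \<in> ?G" using refl by (intro generated_mult)
  qed
  then show "W \<subseteq> ?G" by blast
qed

section \<open>Length and exchange\<close>

lemma word_prod_simps [simp]:
  "word_prod R [] = id" "word_prod R (i # is) = s (\<alpha> i) \<circ> word_prod R is"
  by (simp_all add: word_prod_def)

lemma word_prod_append: "word_prod R (is @ js) = word_prod R is \<circ> word_prod R js"
  by (induction "is") (auto simp: comp_assoc)

lemma generated_words: "generated ((\<lambda>i. s (\<alpha> i)) ` J) = word_prod R ` {is. set is \<subseteq> J}"
proof
  show "generated ((\<lambda>i. s (\<alpha> i)) ` J) \<subseteq> word_prod R ` {is. set is \<subseteq> J}"
  proof
    fix w assume "w \<in> generated ((\<lambda>i. s (\<alpha> i)) ` J)"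
    then show "w \<in> word_prod R ` {is. set is \<subseteq> J}"
    proof (induction rule: generated.induct)
      case generated_id
      show "id \<in> word_prod R ` {is. set is \<subseteq> J}" by (rule image_eqI[of _ _ "[]"]) auto
    next
      case (generated_comp t w)
      then obtain i "is" where "i \<in> J" "t = s (\<alpha> i)" "set is \<subseteq> J" "w = word_prod R is" by auto
      then show "t \<circ> w \<in> word_prod R ` {is. set is \<subseteq> J}"
        by (intro image_eqI[of _ _ "i # is"]) auto
    qed
  qed
  have "set is \<subseteq> J \<Longrightarrow> word_prod R is \<in> generated ((\<lambda>i. s (\<alpha> i)) ` J)" for "is"
    by (induction "is") (auto intro: generated.intros)
  then show "word_prod R ` {is. set is \<subseteq> J} \<subseteq> generated ((\<lambda>i. s (\<alpha> i)) ` J)" by auto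
qed

lemma word_prod_in_W: "word_prod R is \<in> W"
  using generated_words[of UNIV] W_generated_by_simple by auto

lemma W_word: "w \<in> W \<Longrightarrow> \<exists>is. w = word_prod R is"
  using generated_words[of UNIV] W_generated_by_simple by auto

lemma len_le: "len (word_prod R is) \<le> length is"
  unfolding weyl_length_def by (rule Least_le) auto

lemma reduced_word_exists:
  assumes "w \<in> W" shows "\<exists>is. reduced_word R w is"
proof -
  have "\<exists>k is. length is = k \<and> word_prod R is = w" using W_word[OF assms] by auto
  then have "\<exists>is. length is = len w \<and> word_prod R is = w"
    unfolding weyl_length_def by (rule LeastI_ex)
  then show ?thesis by (auto simp: reduced_word_def)
qed

lemma len_id [simp]: "len id = 0"
  using len_le[of "[]"] by simp

lemma len_eq_0: "w \<in> W \<Longrightarrow> len w = 0 \<Longrightarrow> w = id"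
  using reduced_word_exists[of w] by (auto simp: reduced_word_def)

lemma len_comp_le:
  assumes "u \<in> W" "v \<in> W"
  shows "len (u \<circ> v) \<le> len u + len v"
proof -
  obtain js ks where "reduced_word R u js" "reduced_word R v ks"
    using reduced_word_exists assms by blast
  then show ?thesis using len_le[of "js @ ks"] by (simp add: reduced_word_def word_prod_append)
qed

text \<open>
  Applying the letters of the word one after another to \<open>\<beta>\<close>, the first letter at which the root turns
  negative is the reflection in the root reached there; conjugating it back shows that multiplying by
  \<open>s \<beta>\<close> deletes this letter.  The letters of the new word are among the old ones, so the result
  also applies inside parabolic subgroups.
\<close>
lemma strong_exchange:
  assumes "\<beta> \<in> Pos" "inv (word_prod R is) \<beta> \<notin> Pos"
  shows "\<exists>js. length js < length is \<and> set js \<subseteq> set is \<and> word_prod R js = s \<beta> \<circ> word_prod R is"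
  using assms
proof (induction "is" arbitrary: \<beta>)
  case (Cons i "is")
  let ?w = "word_prod R is"
  show ?case
  proof (cases "\<beta> = \<alpha> i")
    case True
    then show ?thesis
      by (intro exI[of _ "is"]) (auto simp: fun_eq_iff simple_root)
  next
    case False
    have "inv (word_prod R (i # is)) \<beta> = inv ?w (s (\<alpha> i) \<beta>)"
      by (simp add: inv_comp_W reflection_in_W simple_root word_prod_in_W)
    then have "inv ?w (s (\<alpha> i) \<beta>) \<notin> Pos"
      using Cons.prems(2) by metis
    then obtain js where js: "length js < length is" "set js \<subseteq> set is"
      "word_prod R js = s (s (\<alpha> i) \<beta>) \<circ> ?w"
      using Cons.IH simple_reflection_pos[OF Cons.prems(1) False] by blast
    have "s (s (\<alpha> i) \<beta>) = s (\<alpha> i) \<circ> s \<beta> \<circ> s (\<alpha> i)"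
      using reflection_image[of "s (\<alpha> i)" \<beta>] pos_root[OF Cons.prems(1)]
      by (simp add: reflection_in_W simple_root)
    then have "word_prod R (i # js) = s \<beta> \<circ> word_prod R (i # is)"
      using js(3) by (simp add: fun_eq_iff simple_root)
    then show ?thesis using js(1,2) by (intro exI[of _ "i # js"]) auto
  qed
qed simp

lemma len_reflection_less:
  assumes "w \<in> W" "\<beta> \<in> Pos" "inv w \<beta> \<notin> Pos"
  shows "len (s \<beta> \<circ> w) < len w"
proof -
  obtain "is" where "is": "word_prod R is = w" "length is = len w"
    using reduced_word_exists[OF assms(1)] by (auto simp: reduced_word_def)
  then obtain js where "length js < length is" "word_prod R js = s \<beta> \<circ> w"
    using strong_exchange[of \<beta> "is"] assms by auto
  then show ?thesis using len_le[of js] "is" by simp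
qed

lemma len_reflection_greater:
  assumes "w \<in> W" "\<beta> \<in> Pos" "inv w \<beta> \<in> Pos"
  shows "len w < len (s \<beta> \<circ> w)"
proof -
  have \<beta>: "\<beta> \<in> \<Phi>" using assms pos_root by simp
  have "inv (s \<beta> \<circ> w) \<beta> = - inv w \<beta>"
    using assms(1) \<beta> by (simp add: inv_comp_W reflection_in_W reflection_self W_uminus W_inv)
  then have "inv (s \<beta> \<circ> w) \<beta> \<notin> Pos" using assms(3) pos_not_neg by auto
  then have "len (s \<beta> \<circ> (s \<beta> \<circ> w)) < len (s \<beta> \<circ> w)"
    using assms \<beta> by (intro len_reflection_less W_mult reflection_in_W) auto
  moreover have "s \<beta> \<circ> (s \<beta> \<circ> w) = w" using \<beta> by (simp add: fun_eq_iff)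
  ultimately show ?thesis by simp
qed

lemma len_reflection_less_iff:
  "w \<in> W \<Longrightarrow> \<beta> \<in> Pos \<Longrightarrow> len (s \<beta> \<circ> w) < len w \<longleftrightarrow> inv w \<beta> \<notin> Pos"
  using len_reflection_less len_reflection_greater by (meson less_asym)

lemma len_simple_le:
  assumes "w \<in> W" shows "len (s (\<alpha> i) \<circ> w) \<le> Suc (len w)"
proof -
  obtain "is" where "is": "word_prod R is = w" "length is = len w"
    using reduced_word_exists[OF assms] by (auto simp: reduced_word_def)
  then show ?thesis using len_le[of "i # is"] by simp
qed

lemma simple_simple_comp [simp]: "s (\<alpha> i) \<circ> (s (\<alpha> i) \<circ> w) = w"
  by (simp add: fun_eq_iff simple_root)

lemma len_simple_up:
  assumes "w \<in> W" "inv w (\<alpha> i) \<in> Pos" shows "len (s (\<alpha> i) \<circ> w) = Suc (len w)"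
  using len_simple_le[OF assms(1), of i] len_reflection_greater[OF assms(1) simple_pos assms(2)] by simp

lemma len_simple_down:
  assumes "w \<in> W" "inv w (\<alpha> i) \<notin> Pos" shows "Suc (len (s (\<alpha> i) \<circ> w)) = len w"
  using len_simple_le[OF W_mult[OF simple_in_W assms(1)], of i i]
    len_reflection_less[OF assms(1) simple_pos assms(2)] by simp

lemma len_simple_less_iff: "w \<in> W \<Longrightarrow> len (s (\<alpha> i) \<circ> w) < len w \<longleftrightarrow> inv w (\<alpha> i) \<notin> Pos"
  by (rule len_reflection_less_iff) (auto simp: simple_pos)

lemma len_inv: assumes "w \<in> W" shows "len (inv w) = len w"
proof -
  have rev: "inv (word_prod R is) = word_prod R (rev is)" for "is"
  proof (induction "is")
    case (Cons i "is")
    show "inv (word_prod R (i # is)) = word_prod R (rev (i # is))"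
      by (simp add: inv_comp_W simple_in_W word_prod_in_W word_prod_append simple_root Cons)
  qed simp
  have le: "len (inv w) \<le> len w" if w: "w \<in> W" for w
  proof -
    obtain "is" where "is": "word_prod R is = w" "length is = len w"
      using reduced_word_exists[OF w] by (auto simp: reduced_word_def)
    then show ?thesis using len_le[of "rev is"] rev[of "is"] by simp
  qed
  show ?thesis using le[OF assms] le[OF W_inv[OF assms]] assms by simp
qed

lemma len_right_up:
  assumes "w \<in> W" "w (\<alpha> j) \<in> Pos" shows "len (w \<circ> s (\<alpha> j)) = Suc (len w)"
proof -
  have "inv (w \<circ> s (\<alpha> j)) = s (\<alpha> j) \<circ> inv w"
    using assms by (simp add: inv_comp_W simple_in_W simple_root)
  then have "len (w \<circ> s (\<alpha> j)) = len (s (\<alpha> j) \<circ> inv w)"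
    using len_inv[OF W_mult[OF assms(1) simple_in_W[of j]]] by simp
  also have "\<dots> = Suc (len (inv w))"
    using assms by (intro len_simple_up) (auto simp: W_inv)
  finally show ?thesis using assms by (simp add: len_inv)
qed

lemma len_right_down:
  assumes "w \<in> W" "w (\<alpha> j) \<notin> Pos" shows "Suc (len (w \<circ> s (\<alpha> j))) = len w"
proof -
  have "len (w \<circ> s (\<alpha> j) \<circ> s (\<alpha> j)) = Suc (len (w \<circ> s (\<alpha> j)))"
  proof (rule len_right_up)
    show "(w \<circ> s (\<alpha> j)) (\<alpha> j) \<in> Pos"
      using assms by (simp add: reflection_self simple_root W_uminus uminus_pos_iff W_root)
  qed (use assms in \<open>auto intro: W_mult simple_in_W\<close>)
  then show ?thesis by (simp add: comp_assoc reflection_involution simple_root)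
qed

text \<open>
  Otherwise \<open>w\<close> would make negative the simple root of the first letter of a reduced word of \<open>inv w\<close>.
\<close>
lemma W_preserves_pos_id:
  assumes "w \<in> W" "\<And>i. w (\<alpha> i) \<in> Pos"
  shows "w = id"
proof (rule ccontr)
  assume "w \<noteq> id"
  obtain "is" where "is": "word_prod R is = inv w" "length is = len (inv w)"
    using reduced_word_exists[OF W_inv[OF assms(1)]] by (auto simp: reduced_word_def)
  have "len w \<noteq> 0" using \<open>w \<noteq> id\<close> len_eq_0[OF assms(1)] by blast
  then have "is \<noteq> []" using "is"(2) len_inv[OF assms(1)] by auto
  then obtain i js where js: "is = i # js" by (cases "is") auto
  have "s (\<alpha> i) \<circ> inv w = word_prod R js" unfolding "is"(1)[symmetric] js by simp
  then have "len (s (\<alpha> i) \<circ> inv w) < len (inv w)" using len_le[of js] "is" js by simp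
  then show False
    using len_simple_less_iff[OF W_inv[OF assms(1)]] assms by auto
qed

text \<open>
  These are the roots whose reflections shorten \<open>w\<close> from the left; they will be the labels of the
  edges leaving the coset of a minimal representative \<open>w\<close>.
\<close>
definition inversions :: "(complex^'n \<Rightarrow> complex^'n) \<Rightarrow> (complex^'n) set" where
  "inversions w = {\<beta> \<in> Pos. inv w \<beta> \<notin> Pos}"

lemma finite_pos: "finite Pos"
  using finite_roots pos_root finite_subset[of Pos \<Phi>] by auto

lemma finite_inversions: "finite (inversions w)"
  using finite_pos by (simp add: inversions_def)

lemma inversions_simple_up:
  assumes w: "w \<in> W" and up: "inv w (\<alpha> i) \<in> Pos"
  shows "inversions (s (\<alpha> i) \<circ> w) = insert (\<alpha> i) (s (\<alpha> i) ` inversions w)"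
proof -
  have inv: "inv (s (\<alpha> i) \<circ> w) \<beta> = inv w (s (\<alpha> i) \<beta>)" for \<beta>
    using w by (simp add: inv_comp_W simple_in_W simple_root)
  have iff: "\<beta> \<in> inversions (s (\<alpha> i) \<circ> w) \<longleftrightarrow> s (\<alpha> i) \<beta> \<in> inversions w" if "\<beta> \<noteq> \<alpha> i" "\<beta> \<in> Pos" for \<beta>
    using that simple_reflection_pos[OF that(2,1)] by (simp add: inversions_def inv)
  have "\<alpha> i \<in> inversions (s (\<alpha> i) \<circ> w)"
    using w up by (simp add: inversions_def inv simple_pos reflection_self simple_root W_uminus W_inv
        pos_not_neg)
  moreover have "s (\<alpha> i) \<beta> \<in> inversions (s (\<alpha> i) \<circ> w)" if "\<beta> \<in> inversions w" for \<beta>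
  proof -
    have "\<beta> \<in> Pos" "\<beta> \<noteq> \<alpha> i" using that up by (auto simp: inversions_def)
    then show ?thesis
      using that iff[of "s (\<alpha> i) \<beta>"] simple_reflection_pos simple_reflection_neq by (simp add: simple_root)
  qed
  moreover have "\<beta> \<in> insert (\<alpha> i) (s (\<alpha> i) ` inversions w)" if "\<beta> \<in> inversions (s (\<alpha> i) \<circ> w)" for \<beta>
  proof (cases "\<beta> = \<alpha> i")
    case False
    then have "s (\<alpha> i) \<beta> \<in> inversions w" using that iff by (auto simp: inversions_def)
    moreover have "\<beta> = s (\<alpha> i) (s (\<alpha> i) \<beta>)" by (simp add: simple_root)
    ultimately show ?thesis by blast
  qed simp
  ultimately show ?thesis by blast
qed

lemma simple_notin_image_inversions: "\<alpha> i \<notin> s (\<alpha> i) ` inversions w"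
  by (metis (no_types, lifting) image_iff inversions_def mem_Collect_eq simple_reflection_neq)

lemma inj_reflection: "\<beta> \<in> \<Phi> \<Longrightarrow> inj (s \<beta>)"
  by (metis injI reflection_reflection)

text \<open>
  Prefixing a letter that increases the length adds exactly one inversion (\<open>inversions_simple_up\<close>).
\<close>
lemma card_inversions: "w \<in> W \<Longrightarrow> card (inversions w) = len w"
proof (induction "len w" arbitrary: w)
  case 0
  then have "w = id" using len_eq_0[of w] by simp
  then have "inversions w = {}" by (simp add: inversions_def)
  then show ?case using 0 by simp
next
  case (Suc k)
  obtain "is" where "is": "word_prod R is = w" "length is = len w"
    using reduced_word_exists[OF Suc.prems] by (auto simp: reduced_word_def)
  then obtain i js where js: "is = i # js" using Suc.hyps by (cases "is") auto
  define u where "u = s (\<alpha> i) \<circ> w"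
  have "u = word_prod R js" unfolding u_def "is"(1)[symmetric] js by simp
  then have u: "u \<in> W" "len u < len w" using word_prod_in_W len_le[of js] "is" js by auto
  have w: "w = s (\<alpha> i) \<circ> u" by (simp add: u_def)
  have up: "inv u (\<alpha> i) \<in> Pos"
    using len_simple_less_iff[OF u(1), of i] u(2) w by auto
  then have "len w = Suc (len u)" unfolding w by (rule len_simple_up[OF u(1)])
  then have "card (inversions u) = len u" using Suc u by simp
  then show ?case
    using \<open>len w = Suc (len u)\<close> simple_notin_image_inversions[of i u]
    unfolding w inversions_simple_up[OF u(1) up]
    by (simp add: finite_inversions card_image inj_on_subset[OF inj_reflection[OF simple_root]])
qed

section \<open>The longest element\<close>

lemma len_le_pos: "w \<in> W \<Longrightarrow> len w \<le> card Pos"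
  using card_inversions[of w] card_mono[OF finite_pos, of "inversions w"] by (auto simp: inversions_def)

text \<open>
  If both \<open>inv x\<close> and \<open>inv y\<close> exchange positive and negative roots, then \<open>y \<circ> inv x\<close> preserves positivity.
\<close>
lemma inversions_eq_pos_unique:
  assumes x: "x \<in> W" "inversions x = Pos" and y: "y \<in> W" "inversions y = Pos"
  shows "x = y"
proof -
  have neg: "- inv z (\<alpha> i) \<in> Pos" if "z \<in> W" "inversions z = Pos" for z i
    using that simple_pos[of i] by (auto simp: inversions_def uminus_pos_iff W_root W_inv simple_root)
  have "(y \<circ> inv x) (\<alpha> i) \<in> Pos" for i
  proof (rule ccontr)
    let ?\<gamma> = "- inv x (\<alpha> i)"
    assume "(y \<circ> inv x) (\<alpha> i) \<notin> Pos"
    then have "y ?\<gamma> \<in> Pos"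
      using x y by (simp add: W_uminus uminus_pos_iff W_root W_inv simple_root)
    then have "inv y (y ?\<gamma>) \<notin> Pos" using y(2) unfolding inversions_def by blast
    then show False using neg[OF x] y(1) by simp
  qed
  then have "y \<circ> inv x = id"
    by (intro W_preserves_pos_id) (auto intro: W_mult W_inv x y)
  then have "(y \<circ> inv x) (x v) = x v" for v by simp
  then show ?thesis using x by (auto simp: fun_eq_iff)
qed

text \<open>
  If \<open>inv x\<close> makes every simple root negative then it makes every positive root negative, so every
  positive root is an inversion of \<open>x\<close> and its length is the largest possible.
\<close>
lemma longest_elementI:
  assumes x: "x \<in> W" "\<And>i. inv x (\<alpha> i) \<notin> Pos"
  shows "longest_element R = x"
proof -
  have "inv x \<beta> \<notin> Pos" if \<beta>: "\<beta> \<in> Pos" for \<beta>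
  proof -
    have "inv x \<beta> = inv x (\<Sum>i\<in>UNIV. coeff i \<beta> *s \<alpha> i)" by (simp add: simple_expansion)
    also have "\<dots> = (\<Sum>i\<in>UNIV. coeff i \<beta> *s inv x (\<alpha> i))"
      by (simp add: W_inv W_scale W_sum x(1))
    finally have "Re (coeff j (inv x \<beta>)) = (\<Sum>i\<in>UNIV. Re (coeff i \<beta> * coeff j (inv x (\<alpha> i))))" for j
      by (simp add: coeff_sum coeff_scale)
    also have "\<dots> j \<le> 0" for j
    proof (rule sum_nonpos)
      fix i
      have "0 \<le> Re (coeff j (- inv x (\<alpha> i)))"
        using x by (intro pos_coeff_Re) (simp add: uminus_pos_iff W_root W_inv simple_root)
      moreover have "coeff i \<beta> \<in> \<nat>" using \<beta> by (simp add: pos_roots_iff)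
      ultimately show "Re (coeff i \<beta> * coeff j (inv x (\<alpha> i))) \<le> 0"
        by (auto elim!: Nats_cases simp: coeff_uminus mult_nonneg_nonpos)
    qed
    finally have le: "Re (coeff j (inv x \<beta>)) \<le> 0" for j .
    show ?thesis
    proof
      assume pos: "inv x \<beta> \<in> Pos"
      then obtain j where "0 < Re (coeff j (inv x \<beta>))"
        using pos_coeff_nonzero[OF pos] simple_pos le
        by (metis coeff_simple linorder_not_le one_complex.sel(1) zero_less_one)
      with le[of j] show False by simp
    qed
  qed
  then have inv_x: "inversions x = Pos" by (auto simp: inversions_def)
  show ?thesis
    unfolding longest_element_def
  proof (rule the_equality)
    show "x \<in> W \<and> (\<forall>u\<in>W. len u \<le> len x)"
      using x(1) len_le_pos card_inversions[OF x(1)] inv_x by simp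
    fix u assume u: "u \<in> W \<and> (\<forall>v\<in>W. len v \<le> len u)"
    then have "card (inversions u) = card Pos"
      using x(1) card_inversions[OF x(1)] inv_x card_inversions[of u] len_le_pos[of u]
      by (metis le_antisym)
    then have "inversions u = Pos"
      by (intro card_subset_eq finite_pos) (auto simp: inversions_def)
    then show "u = x" using inversions_eq_pos_unique u x(1) inv_x by blast
  qed
qed

end

section \<open>Bruhat order\<close>

context root_system
begin

abbreviation bruhat (infix "\<preceq>" 50) where "u \<preceq> w \<equiv> bruhat_le R u w"

lemma bruhat_refl [simp]: "w \<preceq> w"
  by (simp add: bruhat_le_def)

lemma bruhat_trans: "u \<preceq> v \<Longrightarrow> v \<preceq> w \<Longrightarrow> u \<preceq> w"
  unfolding bruhat_le_def by (rule rtrancl_trans)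

lemma bruhat_step:
  assumes "w \<in> W" "\<beta> \<in> Pos" "inv w \<beta> \<in> Pos"
  shows "w \<preceq> s \<beta> \<circ> w"
  unfolding bruhat_le_def by (rule r_into_rtrancl) (use assms len_reflection_greater in blast)

lemma bruhat_induct [consumes 2, case_names refl step]:
  assumes "u \<preceq> w" "u \<in> W" "P u"
    and "\<And>x \<beta>. x \<in> W \<Longrightarrow> \<beta> \<in> Pos \<Longrightarrow> inv x \<beta> \<in> Pos \<Longrightarrow> u \<preceq> x \<Longrightarrow> P x \<Longrightarrow> P (s \<beta> \<circ> x)"
  shows "P w"
  using assms(1) unfolding bruhat_le_def
proof (induction rule: rtrancl_induct)
  case base
  show "P u" by (rule assms(3))
next
  case (step y z)
  from step(2) obtain \<beta> where z: "z = s \<beta> \<circ> y" "y \<in> W" "\<beta> \<in> Pos" "len y < len (s \<beta> \<circ> y)"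
    by blast
  then have "inv y \<beta> \<in> Pos" using len_reflection_less[of y \<beta>] by auto
  moreover have "u \<preceq> y" using step(1) by (simp add: bruhat_le_def)
  ultimately show "P z" unfolding z(1) using z step(3) by (intro assms(4))
qed

lemma bruhat_len: "u \<preceq> w \<Longrightarrow> u \<in> W \<Longrightarrow> u = w \<or> len u < len w"
proof (induction rule: bruhat_induct)
  case (step x \<beta>)
  show "u = s \<beta> \<circ> x \<or> len u < len (s \<beta> \<circ> x)"
    using len_reflection_greater[OF step(1-3)] step(5) less_trans by blast
qed simp

definition shorter :: "'n \<Rightarrow> (complex^'n \<Rightarrow> complex^'n) \<Rightarrow> complex^'n \<Rightarrow> complex^'n" where
  "shorter i w = (if inv w (\<alpha> i) \<in> Pos then w else s (\<alpha> i) \<circ> w)"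

lemma inv_simple_comp: "w \<in> W \<Longrightarrow> inv (s (\<alpha> i) \<circ> w) \<beta> = inv w (s (\<alpha> i) \<beta>)"
  by (simp add: inv_comp_W simple_in_W simple_root)

lemma inv_simple_comp_pos: "w \<in> W \<Longrightarrow> inv (s (\<alpha> i) \<circ> w) (\<alpha> i) \<in> Pos \<longleftrightarrow> inv w (\<alpha> i) \<notin> Pos"
  by (simp add: inv_simple_comp reflection_self simple_root W_uminus W_inv uminus_pos_iff W_root)

lemma shorter_simple: "w \<in> W \<Longrightarrow> shorter i (s (\<alpha> i) \<circ> w) = shorter i w"
  by (simp add: shorter_def inv_simple_comp_pos)

lemma shorter_le: assumes "w \<in> W" shows "shorter i w \<preceq> w"
proof (cases "inv w (\<alpha> i) \<in> Pos")
  case False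
  then have "s (\<alpha> i) \<circ> w \<preceq> s (\<alpha> i) \<circ> (s (\<alpha> i) \<circ> w)"
    using assms by (intro bruhat_step W_mult simple_in_W simple_pos) (simp_all add: inv_simple_comp_pos)
  then show ?thesis using False by (simp add: shorter_def)
qed (simp add: shorter_def)

lemma shorter_le_simple: "w \<in> W \<Longrightarrow> shorter i w \<preceq> s (\<alpha> i) \<circ> w"
  using shorter_le[of "s (\<alpha> i) \<circ> w" i] by (simp add: W_mult simple_in_W shorter_simple)

text \<open>
  It suffices to consider a single Bruhat step \<open>x < s\<^sub>\<beta> x\<close>.  If \<open>\<beta> = \<alpha>\<^sub>i\<close>, both ends have the same
  shorter element.  Otherwise \<open>s\<^sub>i x < s\<^sub>i s\<^sub>\<beta> x\<close> is also a step, with the positive root \<open>s\<^sub>i \<beta>\<close>, so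
  the shorter of \<open>x, s\<^sub>i x\<close> lies below both \<open>s\<^sub>\<beta> x\<close> and \<open>s\<^sub>i s\<^sub>\<beta> x\<close>.
\<close>
lemma shorter_mono: "u \<preceq> w \<Longrightarrow> u \<in> W \<Longrightarrow> shorter i u \<preceq> shorter i w"
proof (induction rule: bruhat_induct)
  case (step x \<beta>)
  have "shorter i x \<preceq> shorter i (s \<beta> \<circ> x)"
  proof (cases "\<beta> = \<alpha> i")
    case True
    then show ?thesis using step by (simp add: shorter_simple)
  next
    case False
    let ?\<beta>' = "s (\<alpha> i) \<beta>"
    have eq: "s (\<alpha> i) \<circ> (s \<beta> \<circ> x) = s ?\<beta>' \<circ> (s (\<alpha> i) \<circ> x)"
      using reflection_comp[OF simple_in_W[of i] pos_root[OF step(2)]] by (metis comp_assoc)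
    have "s (\<alpha> i) \<circ> x \<preceq> s ?\<beta>' \<circ> (s (\<alpha> i) \<circ> x)"
      using step False
      by (intro bruhat_step W_mult simple_in_W simple_reflection_pos)
        (simp_all add: inv_simple_comp simple_root)
    then have "s (\<alpha> i) \<circ> x \<preceq> s (\<alpha> i) \<circ> (s \<beta> \<circ> x)" by (simp only: eq)
    then have "shorter i x \<preceq> s (\<alpha> i) \<circ> (s \<beta> \<circ> x)"
      using shorter_le_simple step(1) bruhat_trans by blast
    moreover have "shorter i x \<preceq> s \<beta> \<circ> x"
      using shorter_le bruhat_step step bruhat_trans by blast
    ultimately show ?thesis by (simp add: shorter_def[of i "s \<beta> \<circ> x"])
  qed
  then show "shorter i u \<preceq> shorter i (s \<beta> \<circ> x)" using step bruhat_trans by blast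
qed simp

end

section \<open>Minimal coset representatives\<close>

locale parabolic = root_system R for R :: "'n::finite root_data" +
  fixes J :: "'n set"
begin

abbreviation "WJ \<equiv> parabolic_subgroup R J"
abbreviation "cst \<equiv> coset R J"

lemma WJ_words: "WJ = word_prod R ` {is. set is \<subseteq> J}"
  by (simp add: parabolic_subgroup_def generated_words)

lemma WJ_subset: "x \<in> WJ \<Longrightarrow> x \<in> W"
  using word_prod_in_W by (auto simp: WJ_words)

lemma WJ_id: "id \<in> WJ"
  by (simp add: parabolic_subgroup_def generated_id)

lemma WJ_mult: "x \<in> WJ \<Longrightarrow> y \<in> WJ \<Longrightarrow> x \<circ> y \<in> WJ"
  by (simp add: parabolic_subgroup_def generated_mult)

lemma WJ_inv: "x \<in> WJ \<Longrightarrow> inv x \<in> WJ"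
  unfolding parabolic_subgroup_def
  by (rule conjunct2[OF generated_bij_inv]) (auto simp: reflection_involution simple_root)

lemma WJ_simple: "j \<in> J \<Longrightarrow> s (\<alpha> j) \<in> WJ"
  by (auto simp: parabolic_subgroup_def intro: generated_base)

text \<open>
  Reflections in \<open>\<alpha>\<^sub>j\<close> with \<open>j \<in> J\<close> change only the coefficient of \<open>\<alpha>\<^sub>j\<close>.
\<close>
lemma WJ_coeff:
  assumes "x \<in> WJ" "i \<notin> J"
  shows "coeff i (x v) = coeff i v"
proof -
  have "set is \<subseteq> J \<Longrightarrow> coeff i (word_prod R is v) = coeff i v" for "is"
    by (induction "is") (use assms(2) in \<open>auto simp: coeff_reflection\<close>)
  then show ?thesis using assms(1) by (auto simp: WJ_words)
qed

lemma WJ_descent: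
  assumes "x \<in> WJ" "x \<noteq> id"
  shows "\<exists>j\<in>J. x (\<alpha> j) \<notin> Pos"
proof (rule ccontr)
  assume *: "\<not> ?thesis"
  have "x (\<alpha> i) \<in> Pos" for i
  proof (cases "i \<in> J")
    case False
    then have "coeff i (x (\<alpha> i)) = 1" using assms(1) by (simp add: WJ_coeff coeff_simple)
    then show ?thesis using assms(1)
      by (intro posI_coeff[of _ i]) (auto intro: W_root WJ_subset simple_root)
  qed (use * in blast)
  then show False using W_preserves_pos_id[OF WJ_subset[OF assms(1)]] assms(2) by blast
qed

lemma WJ_reflection:
  assumes "x \<in> WJ" "\<gamma> \<in> Pos" "inv x \<gamma> \<notin> Pos"
  shows "s \<gamma> \<in> WJ"
proof -
  obtain "is" where "is": "x = word_prod R is" "set is \<subseteq> J" using assms(1) by (auto simp: WJ_words)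
  then obtain js where js: "set js \<subseteq> set is" "word_prod R js = s \<gamma> \<circ> x"
    using strong_exchange[OF assms(2)] assms(3) by blast
  have "s \<gamma> \<circ> x \<in> WJ" unfolding js(2)[symmetric] WJ_words using js(1) "is"(2) by blast
  then have "(s \<gamma> \<circ> x) \<circ> inv x \<in> WJ" using WJ_inv[OF assms(1)] by (rule WJ_mult)
  moreover have "(s \<gamma> \<circ> x) \<circ> inv x = s \<gamma>"
    using WJ_subset[OF assms(1)] by (simp add: fun_eq_iff)
  ultimately show ?thesis by simp
qed

text \<open>
  By exchange, an element of the parabolic subgroup changes the sign of a root only if the reflection
  in that root belongs to the subgroup.  This makes the direction of an edge of the moment graph
  independent of the representative.
\<close>
lemma WJ_pos_iff:
  assumes "x \<in> WJ" "\<gamma> \<in> \<Phi>" "s \<gamma> \<notin> WJ"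
  shows "inv x \<gamma> \<in> Pos \<longleftrightarrow> \<gamma> \<in> Pos"
proof (cases "\<gamma> \<in> Pos")
  case True
  then show ?thesis using WJ_reflection assms by blast
next
  case False
  then have "- \<gamma> \<in> Pos" using assms(2) by (simp add: uminus_pos_iff)
  then have "inv x (- \<gamma>) \<in> Pos" using WJ_reflection[of x "- \<gamma>"] assms by (auto simp: reflection_uminus)
  then show ?thesis using False assms
    by (simp add: W_uminus W_inv WJ_subset uminus_pos_iff W_root)
qed

text \<open>
  Minimal length in the coset is expressed by the absence of right descents in \<open>J\<close>; by
  \<open>min_rep_coset\<close> these are exactly the minimal representatives.
\<close>
definition min_reps :: "(complex^'n \<Rightarrow> complex^'n) set" where
  "min_reps = {w \<in> W. \<forall>j\<in>J. w (\<alpha> j) \<in> Pos}"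

lemma min_reps_W: "w \<in> min_reps \<Longrightarrow> w \<in> W"
  by (simp add: min_reps_def)

lemma min_reps_pos:
  assumes w: "w \<in> min_reps" and \<gamma>: "\<gamma> \<in> Pos" "\<And>i. i \<notin> J \<Longrightarrow> coeff i \<gamma> = 0"
  shows "w \<gamma> \<in> Pos"
proof -
  have "w \<gamma> = w (\<Sum>i\<in>UNIV. coeff i \<gamma> *s \<alpha> i)" by (simp add: simple_expansion)
  also have "\<dots> = (\<Sum>i\<in>UNIV. coeff i \<gamma> *s w (\<alpha> i))"
    by (simp add: W_sum W_scale min_reps_W[OF w])
  finally have eq: "coeff k (w \<gamma>) = (\<Sum>i\<in>UNIV. coeff i \<gamma> * coeff k (w (\<alpha> i)))" for k
    by (simp add: coeff_sum coeff_scale)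
  have "coeff i \<gamma> * coeff k (w (\<alpha> i)) \<in> \<nat>" for i k
    using w \<gamma> by (cases "i \<in> J") (auto simp: min_reps_def pos_roots_iff intro: Nats_mult)
  then have "coeff k (w \<gamma>) \<in> \<nat>" for k
    unfolding eq by (induction rule: infinite_finite_induct[of _ "UNIV :: 'n set"]) auto
  then show ?thesis using W_root[OF min_reps_W[OF w] pos_root[OF \<gamma>(1)]] by (simp add: pos_roots_iff)
qed

text \<open>
  Removing a right descent \<open>j \<in> J\<close> from \<open>x\<close> leaves \<open>y\<close> with \<open>y \<alpha>\<^sub>j\<close> a positive root in the span of \<open>J\<close>.
  Since \<open>w\<close> keeps it positive, multiplying \<open>w y\<close> by \<open>s\<^sub>j\<close> on the right adds one to the length and is
  a Bruhat step.
\<close>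
lemma min_reps_comp:
  assumes w: "w \<in> min_reps"
  shows "x \<in> WJ \<Longrightarrow> len (w \<circ> x) = len w + len x \<and> w \<preceq> w \<circ> x"
proof (induction "len x" arbitrary: x rule: less_induct)
  case less
  show ?case
  proof (cases "x = id")
    case False
    then obtain j where j: "j \<in> J" "x (\<alpha> j) \<notin> Pos" using WJ_descent less.prems by blast
    define y where "y = x \<circ> s (\<alpha> j)"
    have xW: "x \<in> W" using less.prems WJ_subset by simp
    have y: "y \<in> WJ" unfolding y_def by (intro WJ_mult less.prems WJ_simple j)
    then have yW: "y \<in> W" by (rule WJ_subset)
    have x: "x = y \<circ> s (\<alpha> j)" by (simp add: y_def comp_assoc reflection_involution simple_root)
    have len: "Suc (len y) = len x" unfolding y_def by (rule len_right_down[OF xW j(2)])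
    have IH: "len (w \<circ> y) = len w + len y" "w \<preceq> w \<circ> y" using less.hyps[of y] len y by auto
    have wW: "w \<in> W" using w by (rule min_reps_W)
    have "y (\<alpha> j) \<in> Pos"
      using j(2) xW by (simp add: y_def reflection_self simple_root W_uminus uminus_pos_iff W_root)
    moreover have "coeff i (y (\<alpha> j)) = 0" if "i \<notin> J" for i
      using WJ_coeff[OF y that] that j(1) by (auto simp: coeff_simple)
    ultimately have pos: "w (y (\<alpha> j)) \<in> Pos" by (rule min_reps_pos[OF w])
    have "len (w \<circ> y \<circ> s (\<alpha> j)) = Suc (len (w \<circ> y))"
      using pos by (intro len_right_up W_mult wW yW) simp
    then have 1: "len (w \<circ> x) = len w + len x" using IH(1) len by (simp add: x comp_assoc)
    have "w \<circ> y \<preceq> s ((w \<circ> y) (\<alpha> j)) \<circ> (w \<circ> y)"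
      using pos wW yW by (intro bruhat_step W_mult) (simp_all add: inv_comp_W simple_pos)
    also have "s ((w \<circ> y) (\<alpha> j)) \<circ> (w \<circ> y) = w \<circ> x"
      using reflection_comp[OF W_mult[OF wW yW] simple_root[of j]] by (simp add: x comp_assoc)
    finally show ?thesis using 1 IH(2) bruhat_trans by blast
  qed simp
qed

lemma mem_coset_iff: "v \<in> cst u \<longleftrightarrow> (\<exists>x\<in>WJ. v = u \<circ> x)"
  by (auto simp: coset_def)

lemma self_in_coset: "u \<in> cst u"
  unfolding mem_coset_iff using WJ_id by (rule bexI[rotated]) simp

lemma coset_comp_WJ:
  assumes "x \<in> WJ" shows "cst (u \<circ> x) = cst u"
proof -
  have "v \<in> cst u" if v: "v \<in> cst (u \<circ> x)" for v
  proof -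
    obtain y where "y \<in> WJ" "v = u \<circ> x \<circ> y" using v by (auto simp: mem_coset_iff)
    then show ?thesis using WJ_mult[OF assms] by (auto simp: mem_coset_iff comp_assoc)
  qed
  moreover have "v \<in> cst (u \<circ> x)" if v: "v \<in> cst u" for v
  proof -
    obtain y where y: "y \<in> WJ" "v = u \<circ> y" using v by (auto simp: mem_coset_iff)
    have "v = u \<circ> x \<circ> (inv x \<circ> y)" using WJ_subset[OF assms] y by (simp add: fun_eq_iff)
    moreover have "inv x \<circ> y \<in> WJ" using WJ_mult WJ_inv assms y by blast
    ultimately show ?thesis unfolding mem_coset_iff by blast
  qed
  ultimately show ?thesis by blast
qed

lemma coset_eqD: "cst u = cst v \<Longrightarrow> \<exists>x\<in>WJ. v = u \<circ> x"
  using self_in_coset[of v] mem_coset_iff[of v u] by blast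

lemma coset_image: "(\<lambda>v. u \<circ> v) ` cst w = cst (u \<circ> w)"
  by (auto simp: coset_def image_image comp_assoc)

lemma coset_comp_cong: "cst w = cst v \<Longrightarrow> cst (u \<circ> w) = cst (u \<circ> v)"
  by (metis coset_image)

lemma coset_in_W: "u \<in> W \<Longrightarrow> v \<in> cst u \<Longrightarrow> v \<in> W"
  by (auto simp: mem_coset_iff intro: W_mult WJ_subset)

lemma min_rep_exists:
  assumes "u \<in> W" shows "\<exists>w\<in>min_reps. cst w = cst u"
proof -
  obtain w where w: "w \<in> cst u" "\<And>v. v \<in> cst u \<Longrightarrow> len w \<le> len v"
    using ex_has_least_nat[of "\<lambda>v. v \<in> cst u" u len] self_in_coset by blast
  have wW: "w \<in> W" using coset_in_W[OF assms w(1)] .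
  have eq: "cst w = cst u" using w(1) coset_comp_WJ by (auto simp: mem_coset_iff)
  have "w (\<alpha> j) \<in> Pos" if "j \<in> J" for j
  proof (rule ccontr)
    assume "w (\<alpha> j) \<notin> Pos"
    then have "len (w \<circ> s (\<alpha> j)) < len w" using len_right_down[OF wW] by fastforce
    moreover have "w \<circ> s (\<alpha> j) \<in> cst u"
      unfolding eq[symmetric] mem_coset_iff using WJ_simple[OF that] by blast
    ultimately show False using w(2) by fastforce
  qed
  then show ?thesis using wW eq by (auto simp: min_reps_def)
qed

lemma min_reps_len_le: "w \<in> min_reps \<Longrightarrow> v \<in> cst w \<Longrightarrow> len w \<le> len v"
  using min_reps_comp by (auto simp: mem_coset_iff)

lemma min_reps_unique:
  assumes "w \<in> min_reps" "v \<in> cst w" "len v \<le> len w" shows "v = w"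
proof -
  obtain x where x: "x \<in> WJ" "v = w \<circ> x" using assms(2) by (auto simp: mem_coset_iff)
  then have "len x = 0" using min_reps_comp[OF assms(1)] assms(3) by auto
  then show ?thesis using x len_eq_0 WJ_subset by fastforce
qed

lemma min_rep_coset: "w \<in> min_reps \<Longrightarrow> min_rep R (cst w) = w"
  unfolding min_rep_def
  by (rule the_equality) (auto intro: self_in_coset min_reps_len_le min_reps_unique)

lemma coset_inj: "w \<in> min_reps \<Longrightarrow> v \<in> min_reps \<Longrightarrow> cst w = cst v \<longleftrightarrow> w = v"
  using min_rep_coset by metis

lemma cosets_eq: "cosets R J = cst ` min_reps"
  unfolding cosets_def using min_rep_exists min_reps_W by blast

lemma finite_cosets: "finite (cosets R J)"
  by (simp add: cosets_def finite_W)

lemma coset_in_cosets: "w \<in> W \<Longrightarrow> cst w \<in> cosets R J"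
  by (simp add: cosets_def)

lemma bruhat_le_P_iff: "w \<in> min_reps \<Longrightarrow> v \<in> min_reps \<Longrightarrow> bruhat_le_P R (cst w) (cst v) \<longleftrightarrow> w \<preceq> v"
  by (simp add: bruhat_le_P_def min_rep_coset)

lemma simple_comp_min_rep_down:
  assumes "w \<in> min_reps" "inv w (\<alpha> i) \<notin> Pos"
  shows "s (\<alpha> i) \<circ> w \<in> min_reps"
proof -
  have wW: "w \<in> W" using assms(1) by (rule min_reps_W)
  have "s (\<alpha> i) (w (\<alpha> j)) \<in> Pos" if "j \<in> J" for j
  proof (rule simple_reflection_pos)
    show "w (\<alpha> j) \<in> Pos" using assms(1) that by (simp add: min_reps_def)
    show "w (\<alpha> j) \<noteq> \<alpha> i" using assms(2) simple_pos[of j] inv_W_apply[OF wW, of "\<alpha> j"] by auto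
  qed
  then show ?thesis using W_mult[OF simple_in_W wW] by (simp add: min_reps_def)
qed

text \<open>
  If \<open>s\<^sub>i w\<close> fails to be minimal, then some root \<open>w \<alpha>\<^sub>j\<close>, \<open>j \<in> J\<close>, becomes negative under \<open>s\<^sub>i\<close>; it must be
  \<open>\<alpha>\<^sub>i\<close>, so that \<open>s\<^sub>i w = w s\<^sub>j\<close>.
\<close>
lemma simple_comp_min_rep:
  assumes "w \<in> min_reps" "s (\<alpha> i) \<circ> w \<notin> min_reps"
  shows "cst (s (\<alpha> i) \<circ> w) = cst w"
proof -
  have wW: "w \<in> W" using assms(1) by (rule min_reps_W)
  obtain j where j: "j \<in> J" "s (\<alpha> i) (w (\<alpha> j)) \<notin> Pos" "w (\<alpha> j) \<in> Pos"
    using assms W_mult[OF simple_in_W wW] by (auto simp: min_reps_def)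
  then have "w (\<alpha> j) = \<alpha> i" using simple_reflection_pos by blast
  then have "s (\<alpha> i) \<circ> w = w \<circ> s (\<alpha> j)" using reflection_comp[OF wW simple_root[of j]] by simp
  then show ?thesis using coset_comp_WJ[OF WJ_simple[OF j(1)]] by simp
qed

lemma min_rep_simple_cases:
  assumes "w \<in> min_reps" "v \<in> min_reps" "cst v = cst (s (\<alpha> i) \<circ> w)"
  shows "v = s (\<alpha> i) \<circ> w \<or> v = w"
  using assms simple_comp_min_rep[of w i] coset_inj by metis

section \<open>Edges of the moment graph\<close>

text \<open>
  Moved to the right of \<open>w\<close>, the reflection in \<open>\<beta>\<close> becomes the one in \<open>inv w \<beta>\<close>; it lies outside
  \<open>W\<^sub>J\<close> because the coset changes, so \<open>WJ_pos_iff\<close> applies.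
\<close>
lemma edge_inversion:
  assumes "w \<in> W" "x \<in> WJ" "\<beta> \<in> Pos" "cst (s \<beta> \<circ> w) \<noteq> cst w"
  shows "inv (w \<circ> x) \<beta> \<in> Pos \<longleftrightarrow> inv w \<beta> \<in> Pos"
proof -
  let ?\<gamma> = "inv w \<beta>"
  have \<gamma>: "?\<gamma> \<in> \<Phi>" using assms by (simp add: W_root W_inv pos_root)
  have "s \<beta> \<circ> w = w \<circ> s ?\<gamma>" using reflection_comp[OF assms(1) \<gamma>] assms(1) by simp
  then have "s ?\<gamma> \<notin> WJ" using assms(4) coset_comp_WJ by metis
  then have "inv x ?\<gamma> \<in> Pos \<longleftrightarrow> ?\<gamma> \<in> Pos" using assms(2) \<gamma> by (intro WJ_pos_iff)
  then show ?thesis using assms(1,2) by (simp add: inv_comp_W WJ_subset)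
qed

lemma inv_reflection_comp: "w \<in> W \<Longrightarrow> \<beta> \<in> \<Phi> \<Longrightarrow> inv (s \<beta> \<circ> w) \<beta> = - inv w \<beta>"
  by (simp add: inv_comp_W reflection_in_W reflection_self W_uminus W_inv)

lemma reflection_reflection_comp [simp]: "\<beta> \<in> \<Phi> \<Longrightarrow> s \<beta> \<circ> (s \<beta> \<circ> w) = w"
  by (simp add: fun_eq_iff)

lemma inversion_changes_coset:
  assumes "w \<in> min_reps" "\<beta> \<in> inversions w"
  shows "cst (s \<beta> \<circ> w) \<noteq> cst w"
proof
  assume "cst (s \<beta> \<circ> w) = cst w"
  then have "len w \<le> len (s \<beta> \<circ> w)"
    using min_reps_len_le[OF assms(1)] self_in_coset by metis
  then show False
    using len_reflection_less[of w \<beta>] assms min_reps_W by (auto simp: inversions_def)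
qed

text \<open>
  An edge leaving \<open>[w]\<close> may be presented by any representative of either end.  Reading it from its
  upper end, \<open>edge_inversion\<close> replaces that representative by the minimal one.
\<close>
lemma edges_out:
  assumes w: "w \<in> min_reps"
  shows "{e \<in> moment_graph R J. fst e = cst w} = (\<lambda>\<beta>. (cst w, \<beta>, cst (s \<beta> \<circ> w))) ` inversions w"
proof
  have wW: "w \<in> W" using w by (rule min_reps_W)
  have out: "e = (cst w, \<beta>, cst (s \<beta> \<circ> w)) \<and> \<beta> \<in> inversions w"
    if v: "v \<in> W" "\<beta> \<in> Pos" "cst (s \<beta> \<circ> v) \<noteq> cst v" "inv v \<beta> \<notin> Pos" "cst v = cst w"
      and e: "e = (cst v, \<beta>, cst (s \<beta> \<circ> v))" for v \<beta> e
  proof -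
    obtain x where x: "x \<in> WJ" "v = w \<circ> x" using coset_eqD v(5) by metis
    have eq: "cst (s \<beta> \<circ> v) = cst (s \<beta> \<circ> w)" using v(5) by (rule coset_comp_cong)
    then have "inv w \<beta> \<notin> Pos" using edge_inversion[OF wW x(1) v(2)] v x(2) by simp
    then show ?thesis using v e eq by (simp add: inversions_def)
  qed
  show "{e \<in> moment_graph R J. fst e = cst w} \<subseteq> (\<lambda>\<beta>. (cst w, \<beta>, cst (s \<beta> \<circ> w))) ` inversions w"
  proof
    fix e assume "e \<in> {e \<in> moment_graph R J. fst e = cst w}"
    then obtain v \<beta> where v: "v \<in> W" "\<beta> \<in> Pos" "cst (s \<beta> \<circ> v) \<noteq> cst v" and fst: "fst e = cst w"
      and e: "e = (if inv v \<beta> \<in> neg_roots R then (cst v, \<beta>, cst (s \<beta> \<circ> v))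
         else (cst (s \<beta> \<circ> v), \<beta>, cst v))"
      unfolding moment_graph_def by blast
    have \<beta>: "\<beta> \<in> \<Phi>" using v(2) by (rule pos_root)
    have neg: "inv v \<beta> \<in> neg_roots R \<longleftrightarrow> inv v \<beta> \<notin> Pos"
      using neg_iff_not_pos W_root W_inv v(1) \<beta> by blast
    show "e \<in> (\<lambda>\<beta>. (cst w, \<beta>, cst (s \<beta> \<circ> w))) ` inversions w"
    proof (cases "inv v \<beta> \<in> Pos")
      case False
      then show ?thesis using out[OF v] e fst neg by auto
    next
      case True
      let ?u = "s \<beta> \<circ> v"
      have "inv ?u \<beta> \<notin> Pos" using True pos_not_neg by (simp add: inv_reflection_comp v(1) \<beta>)
      moreover have "?u \<in> W" using v \<beta> by (intro W_mult reflection_in_W)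
      moreover have "s \<beta> \<circ> ?u = v" using \<beta> by simp
      ultimately show ?thesis using out[of ?u \<beta> e] v e fst neg True by auto
    qed
  qed
  show "(\<lambda>\<beta>. (cst w, \<beta>, cst (s \<beta> \<circ> w))) ` inversions w \<subseteq> {e \<in> moment_graph R J. fst e = cst w}"
  proof
    fix e assume "e \<in> (\<lambda>\<beta>. (cst w, \<beta>, cst (s \<beta> \<circ> w))) ` inversions w"
    then obtain \<beta> where \<beta>: "\<beta> \<in> inversions w" and e: "e = (cst w, \<beta>, cst (s \<beta> \<circ> w))" by blast
    have "\<beta> \<in> Pos" "inv w \<beta> \<notin> Pos" using \<beta> by (auto simp: inversions_def)
    moreover have "inv w \<beta> \<in> neg_roots R"
      using neg_iff_not_pos[OF W_root[OF W_inv[OF wW] pos_root]] calculation by blast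
    ultimately have "e \<in> moment_graph R J"
      unfolding moment_graph_def using e wW inversion_changes_coset[OF w \<beta>]
      by (intro CollectI exI[of _ w] exI[of _ \<beta>]) auto
    then show "e \<in> {e \<in> moment_graph R J. fst e = cst w}" using e by simp
  qed
qed

lemma prod_edges_out:
  assumes "w \<in> min_reps"
  shows "(\<Prod>(a, \<beta>, b)\<in>{e \<in> moment_graph R J. fst e = cst w}. sym_vec \<beta>) = (\<Prod>\<beta>\<in>inversions w. sym_vec \<beta>)"
  unfolding edges_out[OF assms] by (subst prod.reindex) (auto intro: inj_onI)

section \<open>Reaching the top coset\<close>

text \<open>
  Under the hypothesis, the longest element \<open>x\<close> of the coset \<open>w W\<^sub>J\<close> has every left descent: if \<open>s\<^sub>i\<close> shortens \<open>w\<close>, it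
  shortens \<open>x = w z\<close> by additivity of lengths, and otherwise \<open>s\<^sub>i\<close> fixes the coset, so \<open>s\<^sub>i x\<close> cannot
  be longer.
\<close>
lemma coset_of_maximal:
  assumes w: "w \<in> min_reps" and max: "\<And>i. inv w (\<alpha> i) \<in> Pos \<Longrightarrow> s (\<alpha> i) \<circ> w \<notin> min_reps"
  shows "cst w = cst (longest_element R)"
proof -
  have wW: "w \<in> W" using w by (rule min_reps_W)
  have "finite (cst w)" using finite_subset[OF _ finite_W] coset_in_W[OF wW] by blast
  then have "Max (len ` cst w) \<in> len ` cst w" using self_in_coset[of w] by (intro Max_in) auto
  then obtain x where "x \<in> cst w" "Max (len ` cst w) = len x" by blast
  then have x: "x \<in> cst w" "\<And>v. v \<in> cst w \<Longrightarrow> len v \<le> len x"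
    using \<open>finite (cst w)\<close> by (metis Max_ge finite_imageI imageI)+
  have xW: "x \<in> W" using coset_in_W[OF wW x(1)] .
  obtain z where z: "z \<in> WJ" "x = w \<circ> z" using x(1) by (auto simp: mem_coset_iff)
  have "inv x (\<alpha> i) \<notin> Pos" for i
  proof
    assume up: "inv x (\<alpha> i) \<in> Pos"
    have len: "len (s (\<alpha> i) \<circ> x) = Suc (len x)" by (rule len_simple_up[OF xW up])
    show False
    proof (cases "inv w (\<alpha> i) \<in> Pos")
      case True
      then have "cst (s (\<alpha> i) \<circ> w) = cst w" using simple_comp_min_rep[OF w] max by blast
      moreover have "s (\<alpha> i) \<circ> x \<in> cst (s (\<alpha> i) \<circ> w)"
        unfolding mem_coset_iff using z by (auto simp: comp_assoc)
      ultimately show False using x(2) len by fastforce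
    next
      case False
      have "s (\<alpha> i) \<circ> x = (s (\<alpha> i) \<circ> w) \<circ> z" using z by (simp add: comp_assoc)
      then have "len (s (\<alpha> i) \<circ> x) = len (s (\<alpha> i) \<circ> w) + len z"
        using min_reps_comp[OF simple_comp_min_rep_down[OF w False] z(1)] by simp
      moreover have "len x = len w + len z" using min_reps_comp[OF w z(1)] z(2) by simp
      ultimately show False using len_simple_down[OF wW False] len by simp
    qed
  qed
  then have "longest_element R = x" by (intro longest_elementI xW)
  then show ?thesis using z coset_comp_WJ by simp
qed

lemma reach_top:
  assumes "w \<in> min_reps"
  shows "\<exists>is. word_prod R is \<circ> w \<in> min_reps \<and> cst (word_prod R is \<circ> w) = cst (longest_element R) \<and>
    len (word_prod R is \<circ> w) = length is + len w"
  using assms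
proof (induction "card Pos - len w" arbitrary: w rule: less_induct)
  case less
  have wW: "w \<in> W" using less.prems by (rule min_reps_W)
  show ?case
  proof (cases "\<exists>i. inv w (\<alpha> i) \<in> Pos \<and> s (\<alpha> i) \<circ> w \<in> min_reps")
    case True
    then obtain i where i: "inv w (\<alpha> i) \<in> Pos" "s (\<alpha> i) \<circ> w \<in> min_reps" by blast
    have len: "len (s (\<alpha> i) \<circ> w) = Suc (len w)" by (rule len_simple_up[OF wW i(1)])
    moreover have "len (s (\<alpha> i) \<circ> w) \<le> card Pos" by (rule len_le_pos[OF min_reps_W[OF i(2)]])
    ultimately have "card Pos - len (s (\<alpha> i) \<circ> w) < card Pos - len w" by simp
    from less.hyps[OF this i(2)] obtain "is" where
      "word_prod R is \<circ> (s (\<alpha> i) \<circ> w) \<in> min_reps"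
      "cst (word_prod R is \<circ> (s (\<alpha> i) \<circ> w)) = cst (longest_element R)"
      "len (word_prod R is \<circ> (s (\<alpha> i) \<circ> w)) = length is + len (s (\<alpha> i) \<circ> w)" by blast
    moreover have "word_prod R (is @ [i]) \<circ> w = word_prod R is \<circ> (s (\<alpha> i) \<circ> w)"
      by (simp add: word_prod_append comp_assoc)
    ultimately show ?thesis using len by (intro exI[of _ "is @ [i]"]) simp
  next
    case False
    then show ?thesis using coset_of_maximal[OF less.prems] less.prems by (intro exI[of _ "[]"]) auto
  qed
qed

lemma id_min_rep: "id \<in> min_reps"
  by (simp add: min_reps_def id_in_W simple_pos)

definition top_rep :: "complex^'n \<Rightarrow> complex^'n" where
  "top_rep = min_rep R (cst (longest_element R))"

lemma top_rep: "top_rep \<in> min_reps" "cst top_rep = cst (longest_element R)"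
proof -
  obtain u where "u \<in> min_reps" "cst u = cst (longest_element R)"
    using reach_top[OF id_min_rep] by blast
  then show "top_rep \<in> min_reps" "cst top_rep = cst (longest_element R)"
    using min_rep_coset unfolding top_rep_def by metis+
qed

text \<open>
  The climb from \<open>w\<close> to the top multiplies by a word each of whose letters adds one to the length, and \<open>v\<close> is
  the inverse of its product.
\<close>
lemma reach_top_rep:
  assumes "w \<in> min_reps"
  shows "\<exists>v\<in>W. v \<circ> top_rep = w \<and> len v + len w = len top_rep"
proof -
  obtain "is" where "is": "word_prod R is \<circ> w = top_rep" "len top_rep = length is + len w"
    using reach_top[OF assms] coset_inj top_rep by metis
  let ?x = "word_prod R is"
  have x: "?x \<in> W" by (rule word_prod_in_W)
  have wW: "w \<in> W" using assms by (rule min_reps_W)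
  have "inv ?x \<circ> top_rep = w" using x by (simp add: fun_eq_iff "is"(1)[symmetric])
  moreover have "len (inv ?x) + len w = len top_rep"
  proof -
    have "len top_rep \<le> len ?x + len w" using len_comp_le[OF x wW] "is"(1) by simp
    then show ?thesis using "is"(2) len_le[of "is"] len_inv[OF x] by simp
  qed
  ultimately show ?thesis using W_inv[OF x] by blast
qed

lemma len_le_top: "w \<in> min_reps \<Longrightarrow> len w \<le> len top_rep"
  using reach_top_rep by fastforce

end

section \<open>Roots as linear forms\<close>

context root_system
begin

lemma reflection_dvd:
  assumes "\<beta> \<in> \<Phi>" shows "sym_vec \<beta> dvd f - sym_act (s \<beta>) f"
proof (rule dvd_diff_sym_act)
  fix i
  have "sym_vec (axis i 1) - sym_vec (s \<beta> (axis i 1)) = sym_const (coroot R \<beta> (axis i 1)) * sym_vec \<beta>"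
    by (simp add: reflection_def sym_vec_diff sym_vec_scale)
  then show "sym_vec \<beta> dvd sym_vec (axis i 1) - sym_vec (s \<beta> (axis i 1))" by simp
qed

lemma pos_roots_independent:
  assumes "\<beta> \<in> Pos" "\<gamma> \<in> Pos" "\<beta> \<noteq> \<gamma>"
  shows "\<gamma> \<noteq> c *s \<beta>"
proof
  assume \<gamma>: "\<gamma> = c *s \<beta>"
  then have "c = 1 \<or> c = - 1" using root_multiple[of \<beta> c] assms pos_root by metis
  then have "\<gamma> = \<beta> \<or> \<gamma> = - \<beta>" using \<gamma> by (auto simp: vec_eq_iff)
  then show False using assms pos_not_neg by auto
qed

lemma pos_nonzero: "\<beta> \<in> Pos \<Longrightarrow> \<beta> \<noteq> 0"
  using pos_root root_nonzero by blast

lemma simple_nonzero: "\<alpha> i \<noteq> 0"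
  using pos_nonzero simple_pos by blast

lemma inversions_pairwise_independent: "pairwise_independent (inversions w)"
  using pos_nonzero pos_roots_independent by (auto simp: pairwise_independent_def inversions_def)

abbreviation "inversion_prod w \<equiv> (\<Prod>\<beta>\<in>inversions w. sym_vec \<beta>)"

lemma sym_act_simple [simp]: "sym_act (s (\<alpha> i)) (sym_act (s (\<alpha> i)) f) = f"
  by (simp add: sym_act_comp linear_reflection simple_root reflection_involution)

lemma sym_act_simple_vec: "sym_act (s (\<alpha> i)) (sym_vec x) = sym_vec (s (\<alpha> i) x)"
  by (simp add: sym_act_vec linear_reflection simple_root)

text \<open>
  The inversions of \<open>w\<close> are \<open>\<alpha>\<^sub>i\<close> and the \<open>s\<^sub>i\<close>-images of those of \<open>s\<^sub>i w\<close>.  The sign from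
  \<open>s\<^sub>i \<alpha>\<^sub>i = - \<alpha>\<^sub>i\<close> is the one that makes the descended class take a product of \<^emph>\<open>positive\<close> roots.
\<close>
lemma inversion_prod_down:
  assumes "w \<in> W" "inv w (\<alpha> i) \<notin> Pos"
  shows "sym_act (s (\<alpha> i)) (inversion_prod w) = - (sym_vec (\<alpha> i) * inversion_prod (s (\<alpha> i) \<circ> w))"
proof -
  let ?u = "s (\<alpha> i) \<circ> w"
  have u: "?u \<in> W" by (intro W_mult simple_in_W assms)
  have "inv ?u (\<alpha> i) \<in> Pos" using assms by (simp add: inv_simple_comp_pos)
  from inversions_simple_up[OF u this]
  have "inversions w = insert (\<alpha> i) (s (\<alpha> i) ` inversions ?u)" by simp
  then have "inversion_prod w = sym_vec (\<alpha> i) * (\<Prod>\<beta>\<in>s (\<alpha> i) ` inversions ?u. sym_vec \<beta>)"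
    by (simp add: finite_inversions simple_notin_image_inversions)
  also have "(\<Prod>\<beta>\<in>s (\<alpha> i) ` inversions ?u. sym_vec \<beta>) = (\<Prod>\<beta>\<in>inversions ?u. sym_vec (s (\<alpha> i) \<beta>))"
    by (subst prod.reindex) (auto intro: inj_on_subset[OF inj_reflection[OF simple_root]])
  finally show ?thesis
    by (simp add: sym_act_mult sym_act_prod sym_act_simple_vec reflection_self simple_root sym_vec_uminus)
qed

definition height :: "complex^'n \<Rightarrow> complex" where
  "height x = (\<Sum>i\<in>UNIV. coeff i x)"

lemma linear_height: "Vector_Spaces.linear (*s) (*) height"
  unfolding Vector_Spaces.linear_iff
  by (auto simp: height_def coeff_add coeff_scale sum.distrib sum_distrib_left
      vec.vector_space_axioms vector_space_over_itself.vector_space_axioms)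

lemma height_pos:
  assumes "\<beta> \<in> Pos" shows "\<exists>r>0. height \<beta> = of_real r"
proof -
  have real: "coeff i \<beta> = of_real (Re (coeff i \<beta>))" for i
    using assms by (auto simp: pos_roots_iff elim!: Nats_cases dest!: spec[of _ i])
  have "\<exists>j. coeff j \<beta> \<noteq> 0" using coeff_eqI[of \<beta> 0] pos_nonzero[OF assms] by auto
  then obtain j where "Re (coeff j \<beta>) \<noteq> 0" using real by (metis of_real_0)
  then have "0 < (\<Sum>i\<in>UNIV. Re (coeff i \<beta>))"
    using pos_coeff_Re[OF assms] by (intro sum_pos2[of UNIV j]) (auto simp: less_le)
  moreover have "height \<beta> = of_real (\<Sum>i\<in>UNIV. Re (coeff i \<beta>))"
    unfolding height_def of_real_sum using real by (intro sum.cong) auto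
  ultimately show ?thesis by blast
qed

end

section \<open>The GKM condition and divided differences\<close>

context parabolic
begin

abbreviation "H \<equiv> equivariant_cohomology R J"
abbreviation "\<delta> \<equiv> div_diff R J"

text \<open>
  For \<open>[s\<^sub>\<beta> w] = [w]\<close> the divisibility is trivial, so the condition can be stated for all \<open>w\<close> and \<open>\<beta>\<close>.
  Separating it from the domain restriction makes it stable under pointwise differences.
\<close>
definition gkm :: "'n gkm_class \<Rightarrow> bool" where
  "gkm p \<longleftrightarrow> (\<forall>w\<in>W. \<forall>\<beta>\<in>Pos. sym_vec \<beta> dvd p (cst (s \<beta> \<circ> w)) - p (cst w))"

lemma H_iff: "p \<in> H \<longleftrightarrow> p \<in> cosets R J \<rightarrow>\<^sub>E UNIV \<and> gkm p"
proof -
  have "(cst (s \<beta> \<circ> w) \<noteq> cst w \<longrightarrow> sym_vec \<beta> dvd p (cst (s \<beta> \<circ> w)) - p (cst w)) \<longleftrightarrow>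
      sym_vec \<beta> dvd p (cst (s \<beta> \<circ> w)) - p (cst w)" for w \<beta>
    by (cases "cst (s \<beta> \<circ> w) = cst w") auto
  then show ?thesis by (auto simp: equivariant_cohomology_def gkm_def)
qed

lemma gkmD: "gkm p \<Longrightarrow> w \<in> W \<Longrightarrow> \<beta> \<in> Pos \<Longrightarrow> sym_vec \<beta> dvd p (cst (s \<beta> \<circ> w)) - p (cst w)"
  by (simp add: gkm_def)

lemma H_gkm: "p \<in> H \<Longrightarrow> gkm p"
  by (simp add: H_iff)

lemma gkm_diff:
  assumes "gkm p" "gkm q" shows "gkm (\<lambda>c. p c - q c)"
  unfolding gkm_def
proof (intro ballI)
  fix w \<beta> assume "w \<in> W" "\<beta> \<in> Pos"
  then have "sym_vec \<beta> dvd (p (cst (s \<beta> \<circ> w)) - p (cst w)) - (q (cst (s \<beta> \<circ> w)) - q (cst w))"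
    using assms by (intro dvd_diff gkmD)
  then show "sym_vec \<beta> dvd (p (cst (s \<beta> \<circ> w)) - q (cst (s \<beta> \<circ> w))) - (p (cst w) - q (cst w))"
    by (simp add: algebra_simps)
qed

lemma class_act_simple:
  "w \<in> W \<Longrightarrow> class_act R J (s (\<alpha> i)) p (cst w) = sym_act (s (\<alpha> i)) (p (cst (s (\<alpha> i) \<circ> w)))"
  by (simp add: class_act_def coset_in_cosets coset_image simple_root)

text \<open>
  Modulo \<open>\<alpha>\<^sub>i\<close>, the value \<open>p([w])\<close> agrees with \<open>p([s\<^sub>i w])\<close> by the GKM condition, and \<open>p([s\<^sub>i w])\<close>
  agrees with its image under \<open>s\<^sub>i\<close>; so the exact division is legitimate.
\<close>
lemma div_diff_eq:
  assumes "gkm p" "w \<in> W"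
  shows "sym_vec (\<alpha> i) * \<delta> i p (cst w) = p (cst w) - sym_act (s (\<alpha> i)) (p (cst (s (\<alpha> i) \<circ> w)))"
proof -
  let ?u = "s (\<alpha> i) \<circ> w"
  have "sym_vec (\<alpha> i) dvd (p (cst ?u) - sym_act (s (\<alpha> i)) (p (cst ?u))) - (p (cst ?u) - p (cst w))"
    using assms by (intro dvd_diff reflection_dvd gkmD simple_root simple_pos)
  then have "sym_vec (\<alpha> i) dvd p (cst w) - sym_act (s (\<alpha> i)) (p (cst ?u))"
    by (simp add: algebra_simps)
  then obtain q where q: "p (cst w) - sym_act (s (\<alpha> i)) (p (cst ?u)) = sym_vec (\<alpha> i) * q" by (rule dvdE)
  then have "\<delta> i p (cst w) = q"
    using assms(2) by (simp add: div_diff_def coset_in_cosets class_act_simple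
        exact_div_sym_vec[OF simple_nonzero])
  then show ?thesis using q by simp
qed

lemma div_diff_simple_invariant:
  assumes "gkm p" "w \<in> W"
  shows "\<delta> i p (cst (s (\<alpha> i) \<circ> w)) = sym_act (s (\<alpha> i)) (\<delta> i p (cst w))"
proof (rule sym_vec_mult_cancel[OF simple_nonzero])
  let ?u = "s (\<alpha> i) \<circ> w"
  have "sym_act (s (\<alpha> i)) (sym_vec (\<alpha> i) * \<delta> i p (cst w)) = sym_act (s (\<alpha> i)) (p (cst w)) - p (cst ?u)"
    by (simp add: div_diff_eq[OF assms] sym_act_diff)
  then have "sym_vec (\<alpha> i) * sym_act (s (\<alpha> i)) (\<delta> i p (cst w)) = p (cst ?u) - sym_act (s (\<alpha> i)) (p (cst w))"
    by (simp add: sym_act_mult sym_act_simple_vec reflection_self simple_root sym_vec_uminus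
        minus_equation_iff[of "_ * _"])
  also have "\<dots> = sym_vec (\<alpha> i) * \<delta> i p (cst ?u)"
    using div_diff_eq[OF assms(1) W_mult[OF simple_in_W assms(2)], of i i] by simp
  finally show "sym_vec (\<alpha> i) * \<delta> i p (cst ?u) = sym_vec (\<alpha> i) * sym_act (s (\<alpha> i)) (\<delta> i p (cst w))" by simp
qed

text \<open>
  Along an edge labelled \<open>\<alpha>\<^sub>i\<close>, the two values differ by the action of \<open>s\<^sub>i\<close>.  Along an edge labelled \<open>\<beta> \<noteq> \<alpha>\<^sub>i\<close>,
  \<open>s\<^sub>i\<close> takes the edge between \<open>[s\<^sub>i w]\<close> and \<open>[s\<^sub>i s\<^sub>\<beta> w]\<close>, labelled \<open>s\<^sub>i \<beta>\<close>, back to label \<open>\<beta>\<close>; hence \<open>\<beta>\<close>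
  divides \<open>\<alpha>\<^sub>i\<close> times the difference, and \<open>\<beta>\<close> is prime to \<open>\<alpha>\<^sub>i\<close>.
\<close>
lemma div_diff_gkm:
  assumes p: "gkm p" shows "gkm (\<delta> i p)"
  unfolding gkm_def
proof (intro ballI)
  fix w \<beta> assume w: "w \<in> W" and \<beta>: "\<beta> \<in> Pos"
  let ?a = "\<alpha> i" let ?r = "sym_act (s ?a)"
  show "sym_vec \<beta> dvd \<delta> i p (cst (s \<beta> \<circ> w)) - \<delta> i p (cst w)"
  proof (cases "\<beta> = ?a")
    case True
    have "sym_vec ?a dvd - (\<delta> i p (cst w) - ?r (\<delta> i p (cst w)))"
      unfolding dvd_minus_iff by (rule reflection_dvd[OF simple_root])
    then show ?thesis unfolding True div_diff_simple_invariant[OF p w] by simp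
  next
    case False
    let ?b = "s ?a \<beta>" let ?u = "s \<beta> \<circ> w"
    have b: "?b \<in> Pos" using \<beta> False by (rule simple_reflection_pos)
    have uW: "?u \<in> W" using w \<beta> by (intro W_mult reflection_in_W pos_root)
    have eq: "s ?a \<circ> ?u = s ?b \<circ> (s ?a \<circ> w)"
      using reflection_comp[OF simple_in_W[of i] pos_root[OF \<beta>]] by (metis comp_assoc)
    have "sym_vec ?b dvd p (cst (s ?a \<circ> ?u)) - p (cst (s ?a \<circ> w))"
      unfolding eq by (intro gkmD p b W_mult simple_in_W w)
    then obtain g where "p (cst (s ?a \<circ> ?u)) - p (cst (s ?a \<circ> w)) = sym_vec ?b * g" by (rule dvdE)
    then have "?r (p (cst (s ?a \<circ> ?u)) - p (cst (s ?a \<circ> w))) = sym_vec \<beta> * ?r g"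
      by (simp add: sym_act_mult sym_act_simple_vec simple_root)
    then have "sym_vec \<beta> dvd ?r (p (cst (s ?a \<circ> ?u)) - p (cst (s ?a \<circ> w)))" by simp
    moreover have "sym_vec \<beta> dvd p (cst ?u) - p (cst w)" by (rule gkmD[OF p w \<beta>])
    ultimately have "sym_vec \<beta> dvd (p (cst ?u) - p (cst w)) - ?r (p (cst (s ?a \<circ> ?u)) - p (cst (s ?a \<circ> w)))"
      by (rule dvd_diff[rotated])
    also have "\<dots> = sym_vec ?a * (\<delta> i p (cst ?u) - \<delta> i p (cst w))"
      by (simp add: right_diff_distrib div_diff_eq[OF p w] div_diff_eq[OF p uW] sym_act_diff algebra_simps)
    finally show ?thesis
      by (rule sym_vec_prime[rotated 2]) (use \<beta> False pos_nonzero pos_roots_independent simple_pos in auto)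
  qed
qed

lemma div_diff_H: "p \<in> H \<Longrightarrow> \<delta> i p \<in> H"
  using div_diff_gkm unfolding H_iff by (auto simp: div_diff_def)

lemma coset_induct:
  assumes "w \<in> W" "\<And>v. v \<in> min_reps \<Longrightarrow> P (cst v)" shows "P (cst w)"
  using min_rep_exists[OF assms(1)] assms(2) by metis

text \<open>
  A class of degree \<open>k\<close> that vanishes at all cosets of length at most \<open>k\<close> is zero, where the factor
  \<open>\<kappa>\<close> plays the role of \<open>2 ^ k\<close>.  Going up in length, all lower neighbours of \<open>[w]\<close> have value zero, so the
  value at \<open>[w]\<close> is divisible by \<open>len w\<close> pairwise independent linear forms, too many for its degree.
\<close>
lemma gkm_vanishing:
  assumes p: "gkm p" and scales: "\<And>w. w \<in> min_reps \<Longrightarrow> scales_by \<kappa> (p (cst w))"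
    and low: "\<And>w. w \<in> min_reps \<Longrightarrow> 2 ^ len w \<le> norm \<kappa> \<Longrightarrow> p (cst w) = 0"
  shows "w \<in> min_reps \<Longrightarrow> p (cst w) = 0"
proof (induction "len w" arbitrary: w rule: less_induct)
  case less
  have wW: "w \<in> W" using less.prems by (rule min_reps_W)
  show ?case
  proof (cases "2 ^ len w \<le> norm \<kappa>")
    case False
    have "sym_vec \<beta> dvd p (cst w)" if \<beta>: "\<beta> \<in> inversions w" for \<beta>
    proof -
      have pos: "\<beta> \<in> Pos" "inv w \<beta> \<notin> Pos" using \<beta> by (auto simp: inversions_def)
      let ?u = "s \<beta> \<circ> w"
      have "?u \<in> W" using wW pos by (intro W_mult reflection_in_W pos_root)
      then obtain v where v: "v \<in> min_reps" "cst v = cst ?u" using min_rep_exists by blast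
      have "len v \<le> len ?u" using min_reps_len_le[OF v(1)] self_in_coset v(2) by metis
      also have "\<dots> < len w" by (rule len_reflection_less[OF wW pos])
      finally have "p (cst ?u) = 0" using less.hyps v by metis
      then show ?thesis using gkmD[OF p wW pos(1)] by simp
    qed
    then have "inversion_prod w dvd p (cst w)"
      by (intro prod_sym_vec_dvd finite_inversions inversions_pairwise_independent)
    then obtain g where g: "p (cst w) = inversion_prod w * g" by (rule dvdE)
    have "0 \<notin> inversions w" using inversions_pairwise_independent by (simp add: pairwise_independent_def)
    then have "scales_by (\<kappa> / 2 ^ len w) g"
      using scales_by_divide_prod[OF finite_inversions, of w \<kappa> g] scales[OF less.prems]
      by (simp add: g card_inversions[OF wW])
    then have "g = 0"
      by (rule scales_by_less_1) (use False in \<open>simp add: norm_divide norm_power\<close>)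
    then show ?thesis using g by simp
  qed (use low less.prems in blast)
qed

section \<open>Flow-up classes\<close>

text \<open>
  The properties of the Schubert class of \<open>[w]\<close>, with the degree made explicit and the support only
  bounded by the Bruhat up-set.  The weaker support condition passes to \<open>\<delta>\<^sub>i p\<close> directly, and
  it already determines the class.
\<close>
definition flow_up :: "(complex^'n \<Rightarrow> complex^'n) \<Rightarrow> 'n gkm_class \<Rightarrow> bool" where
  "flow_up w p \<longleftrightarrow> p \<in> H \<and> (\<forall>v\<in>min_reps. scales_by (2 ^ len w) (p (cst v))) \<and>
     (\<forall>v\<in>min_reps. p (cst v) \<noteq> 0 \<longrightarrow> w \<preceq> v) \<and> p (cst w) = inversion_prod w"

lemma flow_up_unique:
  assumes w: "w \<in> min_reps" and p: "flow_up w p" and q: "flow_up w q"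
  shows "p = q"
proof -
  have "p (cst v) - q (cst v) = 0" if "v \<in> min_reps" for v
  proof (rule gkm_vanishing[where p = "\<lambda>c. p c - q c" and \<kappa> = "2 ^ len w"])
    show "gkm (\<lambda>c. p c - q c)" using p q by (auto simp: flow_up_def H_iff intro: gkm_diff)
    show "scales_by (2 ^ len w) (p (cst u) - q (cst u))" if "u \<in> min_reps" for u
      using p q that by (auto simp: flow_up_def intro: scales_by_diff)
    show "p (cst u) - q (cst u) = 0"
      if u: "u \<in> min_reps" and len: "2 ^ len u \<le> norm ((2::complex) ^ len w)" for u
    proof -
      have "len u \<le> len w" using len by (simp add: norm_power)
      then have "w \<preceq> u \<Longrightarrow> u = w" using bruhat_len[of w u] min_reps_W[OF w] by auto
      then show ?thesis using p q u unfolding flow_up_def by (metis diff_self)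
    qed
  qed (rule that)
  then have "p c = q c" if "c \<in> cosets R J" for c using that by (auto simp: cosets_eq)
  then show ?thesis using p q by (intro PiE_ext[of p "cosets R J"]) (auto simp: flow_up_def H_iff)
qed

text \<open>
  A nonzero value of \<open>\<delta>\<^sub>i p\<close> at \<open>[v]\<close> comes from a nonzero value of \<open>p\<close> at \<open>[v]\<close> or at \<open>[s\<^sub>i v]\<close>, and
  the minimal representatives of these two cosets have the same shorter element.
\<close>
lemma div_diff_support:
  assumes p: "gkm p" and supp: "\<And>v. v \<in> min_reps \<Longrightarrow> p (cst v) \<noteq> 0 \<Longrightarrow> w \<preceq> v"
    and w: "w \<in> W" and v: "v \<in> min_reps" and nz: "\<delta> i p (cst v) \<noteq> 0"
  shows "shorter i w \<preceq> v"
proof -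
  have vW: "v \<in> W" using v by (rule min_reps_W)
  (* The minimal representative u of [s_i v] is either s_i v or v itself. *)
  have le: "shorter i w \<preceq> v" if u: "u \<in> min_reps" "p (cst u) \<noteq> 0" "u = v \<or> u = s (\<alpha> i) \<circ> v" for u
  proof -
    have "shorter i w \<preceq> shorter i u" using supp[OF u(1,2)] w by (rule shorter_mono)
    also have "shorter i u = shorter i v" using u(3) shorter_simple[OF vW] by auto
    finally show ?thesis using shorter_le[OF vW] bruhat_trans by blast
  qed
  show ?thesis
  proof (cases "p (cst v) = 0")
    case True
    then have "p (cst (s (\<alpha> i) \<circ> v)) \<noteq> 0"
      using div_diff_eq[OF p vW, of i] nz sym_vec_mult_eq_0[OF simple_nonzero] by auto
    moreover obtain u where "u \<in> min_reps" "cst u = cst (s (\<alpha> i) \<circ> v)"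
      using min_rep_exists[OF W_mult[OF simple_in_W vW]] by blast
    ultimately show ?thesis using le[of u] min_rep_simple_cases[OF v] by metis
  qed (use le v in blast)
qed

lemma div_diff_scales:
  assumes "gkm p" "\<And>v. v \<in> min_reps \<Longrightarrow> scales_by \<kappa> (p (cst v))" "v \<in> min_reps"
  shows "scales_by (\<kappa> / 2) (\<delta> i p (cst v))"
proof (rule scales_by_divide[OF simple_nonzero])
  have vW: "v \<in> W" using assms(3) by (rule min_reps_W)
  have neighbour: "scales_by \<kappa> (p (cst (s (\<alpha> i) \<circ> v)))"
    by (rule coset_induct[OF W_mult[OF simple_in_W vW]]) (rule assms(2))
  show "scales_by \<kappa> (sym_vec (\<alpha> i) * \<delta> i p (cst v))"
    unfolding div_diff_eq[OF assms(1) vW]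
    by (intro scales_by_diff scales_by_sym_act linear_reflection simple_root assms neighbour)
qed

lemma flow_up_down:
  assumes w: "w \<in> min_reps" and down: "inv w (\<alpha> i) \<notin> Pos" and p: "flow_up w p"
  shows "flow_up (s (\<alpha> i) \<circ> w) (\<delta> i p)"
proof -
  let ?u = "s (\<alpha> i) \<circ> w"
  have wW: "w \<in> W" using w by (rule min_reps_W)
  have u: "?u \<in> min_reps" using w down by (rule simple_comp_min_rep_down)
  have uW: "?u \<in> W" using u by (rule min_reps_W)
  have pH: "p \<in> H" and gkm: "gkm p" using p by (auto simp: flow_up_def H_gkm)
  have len: "len w = Suc (len ?u)" using len_simple_down[OF wW down] by simp
  have "scales_by (2 ^ len ?u) (\<delta> i p (cst v))" if "v \<in> min_reps" for v
    using div_diff_scales[OF gkm _ that, of "2 ^ len w"] p by (simp add: flow_up_def len)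
  moreover have "?u \<preceq> v" if "v \<in> min_reps" "\<delta> i p (cst v) \<noteq> 0" for v
    using div_diff_support[OF gkm _ wW that] p down by (simp add: flow_up_def shorter_def)
  moreover have "\<delta> i p (cst ?u) = inversion_prod ?u"
  proof (rule sym_vec_mult_cancel[OF simple_nonzero])
    have "\<not> w \<preceq> ?u" using bruhat_len[OF _ wW, of ?u] len by auto
    then have "p (cst ?u) = 0" using p u unfolding flow_up_def by blast
    then show "sym_vec (\<alpha> i) * \<delta> i p (cst ?u) = sym_vec (\<alpha> i) * inversion_prod ?u"
      using p inversion_prod_down[OF wW down] by (simp add: div_diff_eq[OF gkm uW] flow_up_def)
  qed
  ultimately show ?thesis using div_diff_H[OF pH] by (simp add: flow_up_def)
qed

text \<open>
  Here \<open>\<delta>\<^sub>i p\<close> would be a class of degree \<open>len w - 1\<close> supported above \<open>w\<close>.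
\<close>
lemma flow_up_flat:
  assumes w: "w \<in> min_reps" and up: "inv w (\<alpha> i) \<in> Pos" and p: "flow_up w p" and v: "v \<in> min_reps"
  shows "\<delta> i p (cst v) = 0"
proof (rule gkm_vanishing[OF _ _ _ v])
  have wW: "w \<in> W" using w by (rule min_reps_W)
  have gkm: "gkm p" using p by (auto simp: flow_up_def H_gkm)
  then show "gkm (\<delta> i p)" by (rule div_diff_gkm)
  show "scales_by (2 ^ len w / 2) (\<delta> i p (cst u))" if "u \<in> min_reps" for u
    using gkm _ that by (rule div_diff_scales) (use p in \<open>simp add: flow_up_def\<close>)
  show "\<delta> i p (cst u) = 0"
    if u: "u \<in> min_reps" and low: "2 ^ len u \<le> norm ((2::complex) ^ len w / 2)" for u
  proof (rule ccontr)
    assume nz: "\<delta> i p (cst u) \<noteq> 0"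
    have "w \<preceq> u"
      using div_diff_support[OF gkm _ wW u nz] p up by (simp add: flow_up_def shorter_def)
    then have "len w \<le> len u" using bruhat_len wW by fastforce
    then have "(2::real) ^ len w \<le> 2 ^ len u" by simp
    moreover have "(2::real) ^ len u \<le> 2 ^ len w / 2" using low by (simp add: norm_divide norm_power)
    ultimately show False by (smt (verit) field_sum_of_halves zero_less_power)
  qed
qed

text \<open>
  An edge entering the top coset would start at a coset with a longer minimal representative.
\<close>
lemma edge_at_top:
  assumes w: "w \<in> W" "cst w = cst top_rep" and \<beta>: "\<beta> \<in> Pos" and ne: "cst (s \<beta> \<circ> w) \<noteq> cst w"
  shows "\<beta> \<in> inversions top_rep"
proof (rule ccontr)
  assume "\<beta> \<notin> inversions top_rep"
  then have pos: "inv top_rep \<beta> \<in> Pos" using \<beta> by (simp add: inversions_def)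
  have tW: "top_rep \<in> W" using top_rep(1) by (rule min_reps_W)
  let ?u = "s \<beta> \<circ> top_rep"
  have uW: "?u \<in> W" using \<beta> tW by (intro W_mult reflection_in_W pos_root)
  have eq: "cst (s \<beta> \<circ> w) = cst ?u" using w(2) by (rule coset_comp_cong)
  obtain v where v: "v \<in> min_reps" "cst v = cst ?u" using min_rep_exists[OF uW] by blast
  have vW: "v \<in> W" using v(1) by (rule min_reps_W)
  obtain x where x: "x \<in> WJ" "?u = v \<circ> x" using coset_eqD[OF v(2)] by blast
  have returns: "cst (s \<beta> \<circ> v) = cst top_rep"
    using coset_comp_cong[OF v(2), of "s \<beta>"] \<beta> by (simp add: pos_root)
  have "inv ?u \<beta> \<notin> Pos" using pos pos_not_neg \<beta> tW by (simp add: inv_reflection_comp pos_root)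
  moreover have "cst (s \<beta> \<circ> v) \<noteq> cst v" using returns v(2) ne eq w(2) by simp
  ultimately have "inv v \<beta> \<notin> Pos" using edge_inversion[OF vW x(1) \<beta>] x(2) by simp
  then have "len (s \<beta> \<circ> v) < len v" by (rule len_reflection_less[OF vW \<beta>])
  moreover have "len top_rep \<le> len (s \<beta> \<circ> v)"
    using min_reps_len_le[OF top_rep(1)] self_in_coset returns by metis
  ultimately show False using len_le_top[OF v(1)] by simp
qed

text \<open>
  The class concentrated at the top coset satisfies the GKM condition because every edge at that coset
  leaves it, so that its label is a factor of the value there.
\<close>
lemma flow_up_top:
  "flow_up top_rep (\<lambda>c\<in>cosets R J. if c = cst top_rep then inversion_prod top_rep else 0)" (is "flow_up _ ?p")
proof -
  have tW: "top_rep \<in> W" using top_rep(1) by (rule min_reps_W)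
  have val: "?p (cst w) = (if cst w = cst top_rep then inversion_prod top_rep else 0)" if "w \<in> W" for w
    using that by (simp add: coset_in_cosets)
  have "gkm ?p"
    unfolding gkm_def
  proof (intro ballI)
    fix w \<beta> assume w: "w \<in> W" and \<beta>: "\<beta> \<in> Pos"
    let ?u = "s \<beta> \<circ> w"
    have uW: "?u \<in> W" using w \<beta> by (intro W_mult reflection_in_W pos_root)
    have dvd: "sym_vec \<beta> dvd inversion_prod top_rep" if "\<beta> \<in> inversions top_rep"
      using finite_inversions that by (rule dvd_prodI)
    have returns: "s \<beta> \<circ> ?u = w" using \<beta> by (simp add: pos_root)
    consider "cst ?u = cst w" | "cst ?u \<noteq> cst w" "cst w = cst top_rep"
      | "cst ?u \<noteq> cst w" "cst ?u = cst top_rep" | "cst w \<noteq> cst top_rep" "cst ?u \<noteq> cst top_rep" by blast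
    then show "sym_vec \<beta> dvd ?p (cst ?u) - ?p (cst w)"
    proof cases
      case 2
      then have "\<beta> \<in> inversions top_rep" using edge_at_top w \<beta> by blast
      then show ?thesis unfolding val[OF uW] val[OF w] using 2 dvd by simp
    next
      case 3
      then have "\<beta> \<in> inversions top_rep" using edge_at_top[OF uW 3(2) \<beta>] unfolding returns by metis
      then show ?thesis unfolding val[OF uW] val[OF w] using 3 dvd by simp
    qed (simp_all only: val[OF uW] val[OF w], simp_all)
  qed
  then have "?p \<in> H" unfolding H_iff by auto
  moreover have "scales_by (2 ^ len top_rep) (inversion_prod top_rep)"
    using scales_by_prod[OF finite_inversions] card_inversions[OF tW] by metis
  ultimately show ?thesis
    using val min_reps_W coset_inj top_rep(1) tW unfolding flow_up_def by auto
qed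

section \<open>Positivity and Schubert classes\<close>

text \<open>
  With \<open>s\<^sub>i y < y\<close> and \<open>u = s\<^sub>i y\<close>, the identity \<open>p([y]) = s\<^sub>i p([u]) + \<alpha>\<^sub>i (\<delta>\<^sub>i p)([y])\<close> reduces the claim to \<open>u\<close>,
  since \<open>\<alpha>\<^sub>i\<close> and the \<open>s\<^sub>i\<close>-images of the inversions of \<open>u\<close> are inversions of \<open>y\<close>.  It is essential to keep
  track of the inversions: \<open>s\<^sub>i\<close> does not preserve sums of products of arbitrary positive roots.
\<close>
lemma flow_up_positive:
  "y \<in> min_reps \<Longrightarrow> w \<in> min_reps \<Longrightarrow> flow_up w p \<Longrightarrow> w \<preceq> y \<Longrightarrow>
     p (cst y) \<in> sums_of_products (inversions y)"
proof (induction "len y" arbitrary: y w p rule: less_induct)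
  case less
  have yW: "y \<in> W" and wW: "w \<in> W" using less.prems min_reps_W by auto
  show ?case
  proof (cases "y = id")
    case True
    then have "w = id" using bruhat_len[OF less.prems(4) wW] by simp
    then show ?thesis using less.prems(3) True
      by (simp add: flow_up_def inversions_def sums_of_products.one)
  next
    case False
    have "\<exists>i. inv y (\<alpha> i) \<notin> Pos"
      using W_preserves_pos_id[OF W_inv[OF yW]] False inv_inv_W[OF yW] by (metis inv_id)
    then obtain i where i: "inv y (\<alpha> i) \<notin> Pos" by blast
    let ?r = "sym_act (s (\<alpha> i))" and ?u = "s (\<alpha> i) \<circ> y"
    have u: "?u \<in> min_reps" using less.prems(1) i by (rule simple_comp_min_rep_down)
    have uW: "?u \<in> W" using u by (rule min_reps_W)
    have len: "len ?u < len y" using len_simple_down[OF yW i] by simp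
    have "inv ?u (\<alpha> i) \<in> Pos" using i yW by (simp add: inv_simple_comp_pos)
    from inversions_simple_up[OF uW this]
    have inv_y: "inversions y = insert (\<alpha> i) (s (\<alpha> i) ` inversions ?u)" by simp
    have act: "?r f \<in> sums_of_products (inversions y)" if "f \<in> sums_of_products (inversions ?u)" for f
    proof (rule sums_of_products_mono)
      show "?r f \<in> sums_of_products (s (\<alpha> i) ` inversions ?u)"
        using that by (intro sym_act_sums_of_products linear_reflection simple_root)
    qed (auto simp: inv_y)
    (* If s_i lengthens w this says w \<preceq> u; otherwise it says s_i w \<preceq> u. *)
    have short: "shorter i w \<preceq> ?u"
      using shorter_mono[OF less.prems(4) wW, of i] i by (simp add: shorter_def)
    have gkm: "gkm p" using less.prems(3) by (auto simp: flow_up_def H_gkm)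
    have p_y: "p (cst y) = ?r (p (cst ?u)) + sym_vec (\<alpha> i) * \<delta> i p (cst y)"
      using div_diff_eq[OF gkm yW, of i] by simp
    show ?thesis
    proof (cases "inv w (\<alpha> i) \<in> Pos")
      case True
      then have "p (cst y) = ?r (p (cst ?u))"
        using p_y flow_up_flat[OF less.prems(2) True less.prems(3,1)] by simp
      then show ?thesis
        using act less.hyps[OF len u less.prems(2,3)] short True by (simp add: shorter_def)
    next
      case False
      let ?v = "s (\<alpha> i) \<circ> w" and ?q = "\<delta> i p"
      have v: "?v \<in> min_reps" using less.prems(2) False by (rule simple_comp_min_rep_down)
      have q: "flow_up ?v ?q" using less.prems(2) False less.prems(3) by (rule flow_up_down)
      have "?v \<preceq> ?u" using short False by (simp add: shorter_def)
      then have "?r (?q (cst ?u)) \<in> sums_of_products (inversions y)"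
        by (intro act less.hyps[OF len u v q])
      (* \<delta>_i p is fixed by s_i, so its value at y is determined by the one at u. *)
      moreover have "?r (?q (cst ?u)) = ?q (cst y)"
        using div_diff_simple_invariant[OF gkm yW, of i] by simp
      ultimately have "sym_vec (\<alpha> i) * ?q (cst y) \<in> sums_of_products (inversions y)"
        by (intro sums_of_products.mult sums_of_products.vec) (auto simp: inv_y)
      moreover have "p (cst ?u) = 0 \<or> ?r (p (cst ?u)) \<in> sums_of_products (inversions y)"
        using act less.hyps[OF len u less.prems(2,3)] less.prems(3) u unfolding flow_up_def by blast
      ultimately show ?thesis unfolding p_y by (auto intro: sums_of_products.add)
    qed
  qed
qed

lemma flow_up_support:
  assumes "w \<in> min_reps" "flow_up w p" "v \<in> min_reps"
  shows "p (cst v) \<noteq> 0 \<longleftrightarrow> w \<preceq> v"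
proof
  assume "w \<preceq> v"
  then have "p (cst v) \<in> sums_of_products (inversions v)"
    by (rule flow_up_positive[OF assms(3,1,2)])
  then show "p (cst v) \<noteq> 0"
    by (rule sums_of_products_nonzero[OF linear_height, rotated]) (auto simp: inversions_def intro: height_pos)
qed (use assms in \<open>auto simp: flow_up_def\<close>)

text \<open>
  A class with the defining properties of the Schubert class is homogeneous of degree \<open>len w\<close>, as this is
  the degree of its nonzero value at \<open>[w]\<close>; so it is a flow-up class, and there is only one.
\<close>
lemma schubert_eq:
  assumes w: "w \<in> min_reps" and p: "flow_up w p"
  shows "schubert R J (cst w) = p"
  unfolding schubert_def prod_edges_out[OF w]
proof (rule the_equality)
  show "p \<in> H \<and> (\<exists>k. \<forall>d\<in>cosets R J. sym_homogeneous k (p d)) \<and>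
    {d \<in> cosets R J. p d \<noteq> 0} = {d \<in> cosets R J. bruhat_le_P R (cst w) d} \<and> p (cst w) = inversion_prod w"
  proof (intro conjI)
    show "p \<in> H" "p (cst w) = inversion_prod w" using p by (auto simp: flow_up_def)
    show "\<exists>k. \<forall>d\<in>cosets R J. sym_homogeneous k (p d)"
      using p by (intro exI[of _ "len w"]) (auto simp: flow_up_def cosets_eq sym_homogeneous_iff)
    show "{d \<in> cosets R J. p d \<noteq> 0} = {d \<in> cosets R J. bruhat_le_P R (cst w) d}"
      using flow_up_support[OF w p] bruhat_le_P_iff[OF w] by (auto simp: cosets_eq)
  qed
next
  fix q
  assume q: "q \<in> H \<and> (\<exists>k. \<forall>d\<in>cosets R J. sym_homogeneous k (q d)) \<and>
    {d \<in> cosets R J. q d \<noteq> 0} = {d \<in> cosets R J. bruhat_le_P R (cst w) d} \<and> q (cst w) = inversion_prod w"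
  have mem: "cst v \<in> cosets R J" if "v \<in> min_reps" for v using that by (simp add: cosets_eq)
  obtain k where k: "\<And>d. d \<in> cosets R J \<Longrightarrow> scales_by (2 ^ k) (q d)"
    using q by (auto simp: sym_homogeneous_iff)
  have "q (cst w) \<noteq> 0"
    using q mem[OF w] bruhat_le_P_iff[OF w w] by auto
  moreover have "scales_by (2 ^ len w) (q (cst w))"
    using q p w by (auto simp: flow_up_def)
  ultimately have "(2::complex) ^ k = 2 ^ len w" using scales_by_unique k[OF mem[OF w]] by blast
  moreover have "w \<preceq> v" if "v \<in> min_reps" "q (cst v) \<noteq> 0" for v
    using q mem[OF that(1)] that bruhat_le_P_iff[OF w that(1)] by blast
  ultimately have "flow_up w q" using q k mem by (auto simp: flow_up_def)
  then show "q = p" using flow_up_unique[OF w] p by blast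
qed

text \<open>
  The combination with coefficient \<open>1\<close> at \<open>[w]\<close> and \<open>0\<close> elsewhere.
\<close>
lemma flow_up_ordinary:
  assumes w: "w \<in> min_reps" and p: "flow_up w p"
  shows "p \<in> ordinary_cohomology R J"
proof -
  have c: "cst w \<in> cosets R J" using w by (simp add: cosets_eq)
  have "p = (\<lambda>d\<in>cosets R J. \<Sum>e\<in>cosets R J. sym_const (if e = cst w then 1 else 0) * schubert R J e d)"
  proof (rule extensionalityI[where A = "cosets R J"])
    show "p \<in> extensional (cosets R J)" using p by (auto simp: flow_up_def H_iff PiE_def)
    fix d assume "d \<in> cosets R J"
    have "(\<Sum>e\<in>cosets R J. sym_const (if e = cst w then 1 else 0) * schubert R J e d) =
        (\<Sum>e\<in>cosets R J. if e = cst w then p d else 0)"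
      by (rule sum.cong) (auto simp: schubert_eq[OF w p])
    then show "p d = (\<lambda>d\<in>cosets R J. \<Sum>e\<in>cosets R J.
        sym_const (if e = cst w then 1 else 0) * schubert R J e d) d"
      using \<open>d \<in> cosets R J\<close> c finite_cosets by simp
  qed auto
  then show ?thesis
    unfolding ordinary_cohomology_def
    by (intro CollectI exI[of _ "\<lambda>e. if e = cst w then 1 else 0"]) simp
qed

section \<open>Descending from the top class\<close>

text \<open>
  Since the total drop in length equals the number of letters, each letter must shorten the element
  it is applied to, so each operator meets a flow-up class that it lowers.  The classes met on the way
  are Schubert classes, hence in the ordinary cohomology, where the restricted operators agree with \<open>\<delta>\<close>.
\<close>
lemma flow_up_along_word:
  assumes u: "u \<in> min_reps" "flow_up u p"
    and len: "len u = length is + len (word_prod R is \<circ> u)"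
  shows "word_prod R is \<circ> u \<in> min_reps \<and>
    flow_up (word_prod R is \<circ> u) (foldr (\<lambda>i F. \<delta> i \<circ> F) is id p) \<and>
    foldr (\<lambda>i F. div_diff_ord R J i \<circ> F) is id p = foldr (\<lambda>i F. \<delta> i \<circ> F) is id p"
  using len
proof (induction "is")
  case (Cons i "is")
  let ?x = "word_prod R is" let ?w = "?x \<circ> u"
  let ?p = "foldr (\<lambda>i F. \<delta> i \<circ> F) is id p"
  have uW: "u \<in> W" using u(1) by (rule min_reps_W)
  have wW: "?w \<in> W" using word_prod_in_W uW by (rule W_mult)
  have prod: "word_prod R (i # is) \<circ> u = s (\<alpha> i) \<circ> ?w" by (simp add: comp_assoc)
  have "u = inv ?x \<circ> ?w" using word_prod_in_W by (simp add: fun_eq_iff)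
  then have "len u \<le> len (inv ?x) + len ?w" using len_comp_le[OF W_inv[OF word_prod_in_W] wW] by metis
  then have 1: "len u \<le> length is + len ?w"
    using len_inv[OF word_prod_in_W, of "is"] len_le[of "is"] by simp
  have 2: "len ?w \<le> Suc (len (s (\<alpha> i) \<circ> ?w))"
    using len_simple_le[OF W_mult[OF simple_in_W[of i] wW], of i] by simp
  have 3: "len u = Suc (length is) + len (s (\<alpha> i) \<circ> ?w)"
    using Cons.prems unfolding prod by (simp only: length_Cons)
  have "len u = length is + len ?w" "len (s (\<alpha> i) \<circ> ?w) < len ?w" using 1 2 3 by linarith+
  then have IH: "?w \<in> min_reps" "flow_up ?w ?p"
      "foldr (\<lambda>i F. div_diff_ord R J i \<circ> F) is id p = ?p"
    and down: "inv ?w (\<alpha> i) \<notin> Pos"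
    using Cons.IH len_simple_less_iff[OF wW] by blast+
  have "foldr (\<lambda>i F. \<delta> i \<circ> F) (i # is) id p = \<delta> i ?p"
    and "foldr (\<lambda>i F. div_diff_ord R J i \<circ> F) (i # is) id p = \<delta> i ?p"
    using IH(3) flow_up_ordinary[OF IH(1,2)] by (simp_all add: div_diff_ord_def)
  then show "word_prod R (i # is) \<circ> u \<in> min_reps \<and>
    flow_up (word_prod R (i # is) \<circ> u) (foldr (\<lambda>i F. \<delta> i \<circ> F) (i # is) id p) \<and>
    foldr (\<lambda>i F. div_diff_ord R J i \<circ> F) (i # is) id p = foldr (\<lambda>i F. \<delta> i \<circ> F) (i # is) id p"
    unfolding prod
    using simple_comp_min_rep_down[OF IH(1) down] flow_up_down[OF IH(1) down IH(2)] by metis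
qed (use u in simp)

text \<open>
  One \<open>v\<close> serves both rings, and whichever reduced word of \<open>v\<close> is chosen.
\<close>
lemma schubert_from_top:
  assumes "c \<in> cosets R J"
  shows "\<exists>v\<in>W.
    schubert R J c = along_reduced_word R \<delta> v (schubert R J (cst (longest_element R))) \<and>
    schubert R J c = along_reduced_word R (div_diff_ord R J) v (schubert R J (cst (longest_element R)))"
proof -
  obtain w where w: "w \<in> min_reps" "c = cst w" using assms by (auto simp: cosets_eq)
  obtain v where v: "v \<in> W" "v \<circ> top_rep = w" "len v + len w = len top_rep"
    using reach_top_rep[OF w(1)] by blast
  define p where "p = schubert R J (cst (longest_element R))"
  have p: "flow_up top_rep p"
    unfolding p_def top_rep(2)[symmetric] schubert_eq[OF top_rep(1) flow_up_top] by (rule flow_up_top)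
  define ks where "ks = (SOME ks. reduced_word R v ks)"
  have "reduced_word R v ks" unfolding ks_def by (rule someI_ex) (rule reduced_word_exists[OF v(1)])
  then have "word_prod R ks = v" "length ks = len v" by (auto simp: reduced_word_def)
  then have "flow_up w (foldr (\<lambda>i F. \<delta> i \<circ> F) ks id p)"
    "foldr (\<lambda>i F. div_diff_ord R J i \<circ> F) ks id p = foldr (\<lambda>i F. \<delta> i \<circ> F) ks id p"
    using flow_up_along_word[OF top_rep(1) p, of ks] v by simp_all
  then have "schubert R J c = along_reduced_word R \<delta> v p"
    "schubert R J c = along_reduced_word R (div_diff_ord R J) v p"
    using schubert_eq[OF w(1)] w(2) unfolding along_reduced_word_def ks_def by simp_all
  then show ?thesis using v(1) unfolding p_def by blast
qed

end

theorem theorem6p1: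
  fixes R :: "'n::finite root_data" and J :: "'n set"
  assumes "semisimple_root_data R"
  shows "\<forall>c \<in> cosets R J.
    (\<exists>v \<in> weyl_group R.
       schubert R J c =
       along_reduced_word R (div_diff R J) v (schubert R J (coset R J (longest_element R)))) \<and>
    (\<exists>v \<in> weyl_group R.
       schubert R J c =
       along_reduced_word R (div_diff_ord R J) v (schubert R J (coset R J (longest_element R))))"
proof -
  interpret parabolic R J by unfold_locales (rule assms)
  show ?thesis using schubert_from_top by blast
qed

end
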